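(* Let $E=E_{1,2,3}$ be a triple vector bundle with base manifold $M$, and let there be given a grid on $E$, consisting of a front-back linear double section $(X_{2,3};X_2,X_3;X)$, a right-left linear double section $(Y_{1,3};Y_1,Y_3;Y)$ and a down-up linear double section $(Z_{1,2};Z_1,Z_2;Z)$. Let $\mathsf{u}_{\mathsf{BF}},\mathsf{u}_{\mathsf{LR}},\mathsf{u}_{\mathsf{UD}}\in\Gamma E_{123}$ be the three ultrawarps of this grid (the sections of the ultracore vector bundle $E_{123}\to M$ given by the Back-Front, Left-Right and Up-Down core double vector bundles, with the orientations fixed in the context). Then $$\mathsf{u}_{\mathsf{BF}}+\mathsf{u}_{\mathsf{LR}}+\mathsf{u}_{\mathsf{UD}}=0 .$$
   Context: All manifolds and maps are smooth. **Double vector bundles.** A double vector bundle $(D;A,B;M)$ is a square of vector bundles $D\to A$, $D\to B$, $A\to M$, $B\to M$ (with $D\to A\to M$ equal to $D\to B\to M$) such that the two structures on $D$ commute in the categorical sense (the structure maps of each vector bundle structure on $D$ are vector bundle morphisms with respect to the other; in particular the interchange law $(d_1+_A d_2)+_B(d_3+_A d_4)=(d_1+_B d_3)+_A(d_2+_B d_4)$ and its analogues for scalar multiplication hold), and such that $D\to A\times_M B$ is a surjective submersion. Here $+_A,-_A$ denote the operations of $D\to A$, and $+_B,-_B$ those of $D\to B$. An element $d\in D$ projecting to $a\in A$, $b\in B$, $m\in M$ has outline $(d;a,b;m)$. The core $C$ of $D$ is the set of elements projecting to zero in both $A$ and $B$; on it the two structures coincide, making $C\to M$ a vector bundle. If $d,d'\in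 D$ have the same outline $(a,b;m)$, there is a unique $c\in C_m$ with $d=d'+_A(c+_B\tilde 0_a)=d'+_B(c+_A\tilde 0_b)$, where $\tilde 0_a$, $\tilde 0_b$ are the zeros of $D\to A$ over $a$ and of $D\to B$ over $b$. We write $d-d'\triangleright c$. A linear section of $D$ is a pair $(\xi,X)$ with $X\in\Gamma A$, $\xi\in\Gamma_BD$ (a section of $D\to B$), such that $\xi$ is a vector bundle morphism from $B\to M$ to $D\to A$ over $X$; similarly with the roles of $A$, $B$ exchanged. A morphism of double vector bundles is a map preserving all four vector bundle structures; it restricts to a vector bundle morphism of the cores, called its core morphism. **Triple vector bundles.** A triple vector bundle is a cube of vector bundle structures $E=E_{1,2,3}\to E_{1,2},E_{1,3},E_{2,3}$; $E_{i,j}\to E_i,E_j$; $E_i\to M$, such that each of the six faces is a double vector bundle, the vector bundle operations in the faces having total space $E$ are morphisms of double vector bundles, and the decomposition condition below holds. The faces are (total space; sides; base): - Back $(E;E_{1,2},E_{1,3};E_1)$, Front $(E_{2,3};E_2,E_3;M)$, - Left $(E;E_{1,2},E_{2,3};E_2)$, Right $(E_{1,3};E_1,E_3;M)$, - Up $(E;E_{1,3},E_{2,3};E_3)$, Down $(E_{1,2};E_1,E_2;M)$. The core of the lower face $E_{i,j}$ is denoted $E_{ij}\to M$; the core of the upper face with base $E_k$ is denoted $E_{ij,k}\to E_k$. The restriction of $E\to E_{i,j}$ gives a vector bundle $E_{ij,k}\to E_{ij}$, and one obtains three core double vector bundles $(E_{23,1};E_1,E_{23};M)$ (Back-Front), $(E_{13,2};E_2,E_{13};M)$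 (Left-Right), $(E_{12,3};E_3,E_{12};M)$ (Up-Down). All three have the same core, the ultracore $E_{123}\to M$, consisting of the elements of $E$ that project to zeros in every bundle structure; the three additions of $E$ coincide on it. Decomposition condition: there is an isomorphism of triple vector bundles from $E$ to the decomposed triple vector bundle $\overline E=E_1\times_ME_2\times_ME_3\times_ME_{12}\times_ME_{13}\times_ME_{23}\times_ME_{123}$ (whose structures are pullbacks of Whitney sums; for example $\overline E$ lies over $E_1\times_ME_2\times_ME_{12}$ as the pullback of $E_3\oplus E_{13}\oplus E_{23}\oplus E_{123}$, and similarly for the others) which is the identity on the seven bundles listed. **Grids.** A down-up linear double section is a collection of sections $Z_{1,2}:E_{1,2}\to E$, $Z_1:E_1\to E_{1,3}$, $Z_2:E_2\to E_{2,3}$, $Z:M\to E_3$ forming a morphism of double vector bundles from the Down face to the Up face; its core morphism is $Z_{12}:E_{12}\to E_{12,3}$. A front-back linear double section is a collection of sections $X_{2,3}:E_{2,3}\to E$, $X_2:E_2\to E_{1,2}$, $X_3:E_3\to E_{1,3}$, $X:M\to E_1$ forming a morphism from the Front face to the Back face, with core morphism $X_{23}:E_{23}\to E_{23,1}$. A right-left linear double section is a collection of sections $Y_{1,3}:E_{1,3}\to E$, $Y_1:E_1\to E_{1,2}$, $Y_3:E_3\to E_{2,3}$, $Y:M\to E_2$ forming a morphism from the Right face to the Left face, with core morphism $Y_{13}:E_{13}\to E_{13,2}$. A grid on $E$ is a set of three linear double sections, one in each of these directions. **Warps of the faces (with orientations).** For $m\in M$ and $e_i\in E_i$, the following relations,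 each read in the corresponding face via the notation $d-d'\triangleright c$, define sections of the core bundles of the faces: - Back: $Z_{1,2}(Y_1(e_1))-Y_{1,3}(Z_1(e_1))\triangleright \mathsf w_{\rm back}(e_1)\in E_{23,1}$; Front: $Z_2(Y(m))-Y_3(Z(m))\triangleright \mathsf w_{\rm front}(m)\in E_{23}$. - Left: $X_{2,3}(Z_2(e_2))-Z_{1,2}(X_2(e_2))\triangleright \mathsf w_{\rm left}(e_2)\in E_{13,2}$; Right: $X_3(Z(m))-Z_1(X(m))\triangleright \mathsf w_{\rm right}(m)\in E_{13}$. - Up: $Y_{1,3}(X_3(e_3))-X_{2,3}(Y_3(e_3))\triangleright \mathsf w_{\rm up}(e_3)\in E_{12,3}$; Down: $Y_1(X(m))-X_2(Y(m))\triangleright \mathsf w_{\rm down}(m)\in E_{12}$. The pairs $(\mathsf w_{\rm back},\mathsf w_{\rm front})$, $(\mathsf w_{\rm left},\mathsf w_{\rm right})$, $(\mathsf w_{\rm up},\mathsf w_{\rm down})$ are linear sections of the Back-Front, Left-Right and Up-Down core double vector bundles respectively, as are $(X_{23},X)$, $(Y_{13},Y)$, $(Z_{12},Z)$. **Ultrawarps.** The ultrawarps are the sections of $E_{123}\to M$ determined, for $m\in M$, in the three core double vector bundles by $$\mathsf w_{\rm back}(X(m))-X_{23}(\mathsf w_{\rm front}(m))\triangleright \mathsf u_{\mathsf{BF}}(m),\quad \mathsf w_{\rm left}(Y(m))-Y_{13}(\mathsf w_{\rm right}(m))\triangleright \mathsf u_{\mathsf{LR}}(m),\quad \mathsf w_{\rm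 up}(Z(m))-Z_{12}(\mathsf w_{\rm down}(m))\triangleright \mathsf u_{\mathsf{UD}}(m).$$ *)

theory Defs
  imports "HOL-Analysis.Analysis"
begin

section \<open>Smooth manifolds\<close>

text \<open>
  \<open>Euclidean_space n\<close> is the library's \<open>n\<close>-dimensional space of real sequences vanishing from
  index \<open>n\<close> on, so \<open>\<real>\<^sup>d \<subseteq> \<real>\<^sup>n\<close> for \<open>d \<le> n\<close> holds literally. A chart is a triple of a
  dimension, a domain and a coordinate map; only the values on the domain matter.
\<close>

primrec C_class :: "nat \<Rightarrow> nat \<Rightarrow> (nat \<Rightarrow> real) set \<Rightarrow> ((nat \<Rightarrow> real) \<Rightarrow> real) \<Rightarrow> bool" where
  "C_class 0 n U f \<longleftrightarrow> continuous_map (subtopology (Euclidean_space n) U) euclideanreal f"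
| "C_class (Suc k) n U f \<longleftrightarrow>
     continuous_map (subtopology (Euclidean_space n) U) euclideanreal f \<and>
     (\<forall>i<n. \<exists>g. (\<forall>x\<in>U. ((\<lambda>t. f (x(i := t))) has_real_derivative g x) (at (x i))) \<and>
                C_class k n U g)"

definition smooth_coords :: "nat \<Rightarrow> (nat \<Rightarrow> real) set \<Rightarrow> ((nat \<Rightarrow> real) \<Rightarrow> nat \<Rightarrow> real) \<Rightarrow> bool" where
  "smooth_coords n U f \<longleftrightarrow> (\<forall>j k. C_class k n U (\<lambda>x. f x j))"

type_synonym 'a chart = "nat \<times> 'a set \<times> ('a \<Rightarrow> nat \<Rightarrow> real)"

record 'a smooth_space =
  top_of :: "'a topology"
  atlas :: "'a chart set"

definition pts :: "'a smooth_space \<Rightarrow> 'a set" where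
  "pts X = topspace (top_of X)"

definition is_chart :: "'a topology \<Rightarrow> 'a chart \<Rightarrow> bool" where
  "is_chart T = (\<lambda>(n, U, \<phi>). openin T U \<and> openin (Euclidean_space n) (\<phi> ` U) \<and>
     homeomorphic_map (subtopology T U) (subtopology (Euclidean_space n) (\<phi> ` U)) \<phi>)"

definition smooth_transition :: "'a chart \<Rightarrow> 'a chart \<Rightarrow> bool" where
  "smooth_transition = (\<lambda>(n, U, \<phi>) (k, V, \<psi>).
     smooth_coords n (\<phi> ` (U \<inter> V)) (\<psi> \<circ> inv_into U \<phi>))"

definition manifold :: "'a smooth_space \<Rightarrow> bool" where
  "manifold X \<longleftrightarrow>
     Hausdorff_space (top_of X) \<and> second_countable (top_of X) \<and>
     (\<forall>c\<in>atlas X. is_chart (top_of X) c) \<and>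
     (\<forall>c\<in>atlas X. \<forall>c'\<in>atlas X. smooth_transition c c') \<and>
     (\<forall>x\<in>pts X. \<exists>(n, U, \<phi>)\<in>atlas X. x \<in> U) \<and>
     (\<exists>d. \<forall>(n, U, \<phi>)\<in>atlas X. n = d)"

definition max_atlas :: "'a smooth_space \<Rightarrow> 'a chart set" where
  "max_atlas X = {c. is_chart (top_of X) c \<and>
     (\<forall>c'\<in>atlas X. smooth_transition c c' \<and> smooth_transition c' c)}"

definition smooth_map :: "'a smooth_space \<Rightarrow> 'b smooth_space \<Rightarrow> ('a \<Rightarrow> 'b) \<Rightarrow> bool" where
  "smooth_map X Y f \<longleftrightarrow>
     continuous_map (top_of X) (top_of Y) f \<and>
     (\<forall>(n, U, \<phi>)\<in>atlas X. \<forall>(k, V, \<psi>)\<in>atlas Y.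
        smooth_coords n (\<phi> ` (U \<inter> f -` V)) (\<psi> \<circ> f \<circ> inv_into U \<phi>))"

definition diffeomorphism :: "'a smooth_space \<Rightarrow> 'b smooth_space \<Rightarrow> ('a \<Rightarrow> 'b) \<Rightarrow> bool" where
  "diffeomorphism X Y f \<longleftrightarrow> smooth_map X Y f \<and>
     (\<exists>g. smooth_map Y X g \<and> (\<forall>x\<in>pts X. g (f x) = x) \<and> (\<forall>y\<in>pts Y. f (g y) = y))"

definition euclid :: "nat \<Rightarrow> (nat \<Rightarrow> real) smooth_space" where
  "euclid n = \<lparr>top_of = Euclidean_space n, atlas = {(n, topspace (Euclidean_space n), \<lambda>x. x)}\<rparr>"

definition prod_space :: "'a smooth_space \<Rightarrow> 'b smooth_space \<Rightarrow> ('a \<times> 'b) smooth_space" where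
  "prod_space X Y = \<lparr>top_of = prod_topology (top_of X) (top_of Y),
     atlas = {(n + k, U \<times> V, \<lambda>(x, y) i. if i < n then \<phi> x i else \<psi> y (i - n)) | n U \<phi> k V \<psi>.
                (n, U, \<phi>) \<in> atlas X \<and> (k, V, \<psi>) \<in> atlas Y}\<rparr>"

text \<open>
  The charts of a submanifold are the restrictions of slice charts of the ambient manifold. Below,
  \<open>subspace X S\<close> is only formed for open subsets, for fibre products along vector bundle
  projections and for (ultra)cores, all of which are embedded submanifolds.
\<close>

definition subspace :: "'a smooth_space \<Rightarrow> 'a set \<Rightarrow> 'a smooth_space" where
  "subspace X S = \<lparr>top_of = subtopology (top_of X) S,
     atlas = {(d, U \<inter> S, \<phi>) | d n U \<phi>. (n, U, \<phi>) \<in> max_atlas X \<and> d \<le> n \<and> U \<inter> S \<noteq> {} \<and>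
                \<phi> ` (U \<inter> S) = \<phi> ` U \<inter> topspace (Euclidean_space d)}\<rparr>"

text \<open>
  Surjectivity of the differential, in charts: every vector of the target is the velocity at \<open>0\<close>
  of the image of a straight line through the coordinates of the given point.
\<close>

definition submersion :: "'a smooth_space \<Rightarrow> 'b smooth_space \<Rightarrow> ('a \<Rightarrow> 'b) \<Rightarrow> bool" where
  "submersion X Y f \<longleftrightarrow> smooth_map X Y f \<and>
     (\<forall>x\<in>pts X. \<forall>(n, U, \<phi>)\<in>atlas X. \<forall>(k, V, \<psi>)\<in>atlas Y. x \<in> U \<and> f x \<in> V \<longrightarrow>
        (\<forall>w\<in>topspace (Euclidean_space k). \<exists>v\<in>topspace (Euclidean_space n). \<forall>i<k.
           ((\<lambda>t. \<psi> (f (inv_into U \<phi> (\<lambda>j. \<phi> x j + t * v j))) i) has_real_derivative w i) (at 0)))"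

definition surjective_submersion :: "'a smooth_space \<Rightarrow> 'b smooth_space \<Rightarrow> ('a \<Rightarrow> 'b) \<Rightarrow> bool" where
  "surjective_submersion X Y f \<longleftrightarrow> submersion X Y f \<and> f ` pts X = pts Y"


section \<open>Vector bundles\<close>

record ('e, 'b) vbundle =
  Tot :: "'e smooth_space"
  Base :: "'b smooth_space"
  vproj :: "'e \<Rightarrow> 'b"
  vadd :: "'e \<Rightarrow> 'e \<Rightarrow> 'e"
  vscale :: "real \<Rightarrow> 'e \<Rightarrow> 'e"
  vzero :: "'b \<Rightarrow> 'e"

definition fibre :: "('e, 'b) vbundle \<Rightarrow> 'b \<Rightarrow> 'e set" where
  "fibre V b = {e \<in> pts (Tot V). vproj V e = b}"

definition real_vector_space_on ::
    "'e set \<Rightarrow> ('e \<Rightarrow> 'e \<Rightarrow> 'e) \<Rightarrow> (real \<Rightarrow> 'e \<Rightarrow> 'e) \<Rightarrow> 'e \<Rightarrow> bool" where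
  "real_vector_space_on S ad scl z \<longleftrightarrow>
     z \<in> S \<and>
     (\<forall>x\<in>S. \<forall>y\<in>S. ad x y \<in> S \<and> ad x y = ad y x) \<and>
     (\<forall>x\<in>S. \<forall>y\<in>S. \<forall>w\<in>S. ad (ad x y) w = ad x (ad y w)) \<and>
     (\<forall>x\<in>S. ad z x = x \<and> (\<exists>y\<in>S. ad x y = z)) \<and>
     (\<forall>x\<in>S. \<forall>s. scl s x \<in> S) \<and>
     (\<forall>x\<in>S. \<forall>y\<in>S. \<forall>s. scl s (ad x y) = ad (scl s x) (scl s y)) \<and>
     (\<forall>x\<in>S. \<forall>s t. scl (s + t) x = ad (scl s x) (scl t x) \<and> scl (s * t) x = scl s (scl t x)) \<and>
     (\<forall>x\<in>S. scl 1 x = x)"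

definition local_trivialization ::
    "('e, 'b) vbundle \<Rightarrow> nat \<Rightarrow> 'b set \<Rightarrow> ('e \<Rightarrow> 'b \<times> (nat \<Rightarrow> real)) \<Rightarrow> bool" where
  "local_trivialization V r U \<Phi> \<longleftrightarrow>
     openin (top_of (Base V)) U \<and>
     diffeomorphism (subspace (Tot V) {e \<in> pts (Tot V). vproj V e \<in> U})
                    (prod_space (subspace (Base V) U) (euclid r)) \<Phi> \<and>
     (\<forall>b\<in>U. \<forall>e\<in>fibre V b. fst (\<Phi> e) = b) \<and>
     (\<forall>b\<in>U. \<forall>e\<in>fibre V b. \<forall>e'\<in>fibre V b. \<forall>i.
        snd (\<Phi> (vadd V e e')) i = snd (\<Phi> e) i + snd (\<Phi> e') i) \<and>
     (\<forall>b\<in>U. \<forall>e\<in>fibre V b. \<forall>t i. snd (\<Phi> (vscale V t e)) i = t * snd (\<Phi> e) i)"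

definition vector_bundle :: "('e, 'b) vbundle \<Rightarrow> bool" where
  "vector_bundle V \<longleftrightarrow>
     manifold (Tot V) \<and> manifold (Base V) \<and>
     smooth_map (Tot V) (Base V) (vproj V) \<and>
     (\<forall>b\<in>pts (Base V). real_vector_space_on (fibre V b) (vadd V) (vscale V) (vzero V b)) \<and>
     (\<exists>r. \<forall>b\<in>pts (Base V). \<exists>U \<Phi>. b \<in> U \<and> local_trivialization V r U \<Phi>)"

definition vb_morphism ::
    "('e, 'b) vbundle \<Rightarrow> ('f, 'c) vbundle \<Rightarrow> ('e \<Rightarrow> 'f) \<Rightarrow> ('b \<Rightarrow> 'c) \<Rightarrow> bool" where
  "vb_morphism V W F f \<longleftrightarrow>
     smooth_map (Tot V) (Tot W) F \<and> smooth_map (Base V) (Base W) f \<and>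
     (\<forall>e\<in>pts (Tot V). vproj W (F e) = f (vproj V e)) \<and>
     (\<forall>b\<in>pts (Base V). \<forall>e\<in>fibre V b. \<forall>e'\<in>fibre V b. F (vadd V e e') = vadd W (F e) (F e')) \<and>
     (\<forall>b\<in>pts (Base V). \<forall>e\<in>fibre V b. \<forall>t. F (vscale V t e) = vscale W t (F e))"

definition vb_section :: "('e, 'b) vbundle \<Rightarrow> ('b \<Rightarrow> 'e) \<Rightarrow> bool" where
  "vb_section V s \<longleftrightarrow> smooth_map (Base V) (Tot V) s \<and> (\<forall>b\<in>pts (Base V). vproj V (s b) = b)"

definition restrict_vb :: "('e, 'b) vbundle \<Rightarrow> 'e set \<Rightarrow> 'b set \<Rightarrow> ('e, 'b) vbundle" where
  "restrict_vb V S T = V\<lparr>Tot := subspace (Tot V) S, Base := subspace (Base V) T\<rparr>"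

text \<open>
  For maps \<open>p\<close>, \<open>q\<close> out of the total space and the base of \<open>V : E \<rightarrow> B\<close>, this is the bundle
  \<open>E \<times>\<^sub>p E \<rightarrow> B \<times>\<^sub>q B\<close> with componentwise operations; it is the domain of the addition
  of another vector bundle structure \<open>p\<close> on \<open>E\<close>.
\<close>

definition fibre_square :: "('e, 'b) vbundle \<Rightarrow> ('e \<Rightarrow> 'a) \<Rightarrow> ('b \<Rightarrow> 'm) \<Rightarrow> ('e \<times> 'e, 'b \<times> 'b) vbundle" where
  "fibre_square V p q =
     \<lparr>Tot = subspace (prod_space (Tot V) (Tot V)) {(x, y). p x = p y},
      Base = subspace (prod_space (Base V) (Base V)) {(x, y). q x = q y},
      vproj = (\<lambda>(x, y). (vproj V x, vproj V y)),
      vadd = (\<lambda>(x, y) (x', y'). (vadd V x x', vadd V y y')),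
      vscale = (\<lambda>t (x, y). (vscale V t x, vscale V t y)),
      vzero = (\<lambda>(b, b'). (vzero V b, vzero V b'))\<rparr>"


section \<open>Double vector bundles\<close>

text \<open>\<open>(D; A, B; M)\<close>: \<open>upA\<close> is \<open>D \<rightarrow> A\<close>, \<open>upB\<close> is \<open>D \<rightarrow> B\<close>, \<open>loA\<close> is \<open>A \<rightarrow> M\<close>, \<open>loB\<close> is \<open>B \<rightarrow> M\<close>.\<close>

record ('d, 'a, 'b, 'm) dvb =
  upA :: "('d, 'a) vbundle"
  upB :: "('d, 'b) vbundle"
  loA :: "('a, 'm) vbundle"
  loB :: "('b, 'm) vbundle"

text \<open>
  \<open>structure_maps_linear V W VA VB\<close>: projection, zero section, addition and scalar multiplications
  of \<open>V : D \<rightarrow> A\<close> are vector bundle morphisms with respect to \<open>W : D \<rightarrow> B\<close> and the side bundles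
  \<open>VA : A \<rightarrow> M\<close>, \<open>VB : B \<rightarrow> M\<close>.
\<close>

definition structure_maps_linear ::
    "('d, 'a) vbundle \<Rightarrow> ('d, 'b) vbundle \<Rightarrow> ('a, 'm) vbundle \<Rightarrow> ('b, 'm) vbundle \<Rightarrow> bool" where
  "structure_maps_linear V W VA VB \<longleftrightarrow>
     vb_morphism W VA (vproj V) (vproj VB) \<and>
     vb_morphism VA W (vzero V) (vzero VB) \<and>
     vb_morphism (fibre_square W (vproj V) (vproj VB)) W
       (\<lambda>(d, d'). vadd V d d') (\<lambda>(b, b'). vadd VB b b') \<and>
     (\<forall>t. vb_morphism W W (vscale V t) (vscale VB t))"

definition double_vector_bundle :: "('d, 'a, 'b, 'm) dvb \<Rightarrow> bool" where
  "double_vector_bundle D \<longleftrightarrow>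
     vector_bundle (upA D) \<and> vector_bundle (upB D) \<and>
     vector_bundle (loA D) \<and> vector_bundle (loB D) \<and>
     Tot (upA D) = Tot (upB D) \<and> Base (upA D) = Tot (loA D) \<and>
     Base (upB D) = Tot (loB D) \<and> Base (loA D) = Base (loB D) \<and>
     (\<forall>d\<in>pts (Tot (upA D)).
        vproj (loA D) (vproj (upA D) d) = vproj (loB D) (vproj (upB D) d)) \<and>
     structure_maps_linear (upA D) (upB D) (loA D) (loB D) \<and>
     structure_maps_linear (upB D) (upA D) (loB D) (loA D) \<and>
     surjective_submersion (Tot (upA D))
       (subspace (prod_space (Tot (loA D)) (Tot (loB D))) {(a, b). vproj (loA D) a = vproj (loB D) b})
       (\<lambda>d. (vproj (upA D) d, vproj (upB D) d))"

definition dvb_morphism ::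
    "('d, 'a, 'b, 'm) dvb \<Rightarrow> ('d', 'a', 'b', 'm') dvb \<Rightarrow>
     ('d \<Rightarrow> 'd') \<Rightarrow> ('a \<Rightarrow> 'a') \<Rightarrow> ('b \<Rightarrow> 'b') \<Rightarrow> ('m \<Rightarrow> 'm') \<Rightarrow> bool" where
  "dvb_morphism D D' F FA FB f \<longleftrightarrow>
     vb_morphism (upA D) (upA D') F FA \<and> vb_morphism (upB D) (upB D') F FB \<and>
     vb_morphism (loA D) (loA D') FA f \<and> vb_morphism (loB D) (loB D') FB f"

definition base_pt :: "('d, 'a, 'b, 'm) dvb \<Rightarrow> 'd \<Rightarrow> 'm" where
  "base_pt D d = vproj (loA D) (vproj (upA D) d)"

definition core :: "('d, 'a, 'b, 'm) dvb \<Rightarrow> 'd set" where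
  "core D = {d \<in> pts (Tot (upA D)).
     vproj (upA D) d = vzero (loA D) (base_pt D d) \<and>
     vproj (upB D) d = vzero (loB D) (base_pt D d)}"

text \<open>On the core the operations of \<open>upA\<close> and \<open>upB\<close> coincide; we use those of \<open>upA\<close>.\<close>

definition core_vb :: "('d, 'a, 'b, 'm) dvb \<Rightarrow> ('d, 'm) vbundle" where
  "core_vb D =
     \<lparr>Tot = subspace (Tot (upA D)) (core D), Base = Base (loA D), vproj = base_pt D,
      vadd = vadd (upA D), vscale = vscale (upA D),
      vzero = (\<lambda>m. vzero (upA D) (vzero (loA D) m))\<rparr>"

definition core_morphism :: "('d, 'a, 'b, 'm) dvb \<Rightarrow> ('d \<Rightarrow> 'd') \<Rightarrow> 'd \<Rightarrow> 'd'" where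
  "core_morphism D F = restrict F (core D)"

text \<open>The relation \<open>d - d' \<triangleright> c\<close>, and the unique such \<open>c\<close>.\<close>

definition core_difference_rel :: "('d, 'a, 'b, 'm) dvb \<Rightarrow> 'd \<Rightarrow> 'd \<Rightarrow> 'd \<Rightarrow> bool" where
  "core_difference_rel D d d' c \<longleftrightarrow>
     d \<in> pts (Tot (upA D)) \<and> d' \<in> pts (Tot (upA D)) \<and>
     vproj (upA D) d = vproj (upA D) d' \<and> vproj (upB D) d = vproj (upB D) d' \<and>
     c \<in> core D \<and> base_pt D c = base_pt D d \<and>
     d = vadd (upA D) d' (vadd (upB D) c (vzero (upA D) (vproj (upA D) d))) \<and>
     d = vadd (upB D) d' (vadd (upA D) c (vzero (upB D) (vproj (upB D) d)))"

definition core_difference :: "('d, 'a, 'b, 'm) dvb \<Rightarrow> 'd \<Rightarrow> 'd \<Rightarrow> 'd" where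
  "core_difference D d d' = (THE c. core_difference_rel D d d' c)"


section \<open>Triple vector bundles\<close>

text \<open>\<open>v12\<close> is \<open>E \<rightarrow> E\<^sub>1\<^sub>,\<^sub>2\<close>, \<open>v12_1\<close> is \<open>E\<^sub>1\<^sub>,\<^sub>2 \<rightarrow> E\<^sub>1\<close>, \<open>v1\<close> is \<open>E\<^sub>1 \<rightarrow> M\<close>, and so on.\<close>

record ('e, 'e12, 'e13, 'e23, 'e1, 'e2, 'e3, 'm) tvb =
  v12 :: "('e, 'e12) vbundle"
  v13 :: "('e, 'e13) vbundle"
  v23 :: "('e, 'e23) vbundle"
  v12_1 :: "('e12, 'e1) vbundle"
  v12_2 :: "('e12, 'e2) vbundle"
  v13_1 :: "('e13, 'e1) vbundle"
  v13_3 :: "('e13, 'e3) vbundle"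
  v23_2 :: "('e23, 'e2) vbundle"
  v23_3 :: "('e23, 'e3) vbundle"
  v1 :: "('e1, 'm) vbundle"
  v2 :: "('e2, 'm) vbundle"
  v3 :: "('e3, 'm) vbundle"

context
  fixes T :: "('e, 'e12, 'e13, 'e23, 'e1, 'e2, 'e3, 'm) tvb"
begin

definition back_face :: "('e, 'e12, 'e13, 'e1) dvb" where
  "back_face = \<lparr>upA = v12 T, upB = v13 T, loA = v12_1 T, loB = v13_1 T\<rparr>"

definition front_face :: "('e23, 'e2, 'e3, 'm) dvb" where
  "front_face = \<lparr>upA = v23_2 T, upB = v23_3 T, loA = v2 T, loB = v3 T\<rparr>"

definition left_face :: "('e, 'e12, 'e23, 'e2) dvb" where
  "left_face = \<lparr>upA = v12 T, upB = v23 T, loA = v12_2 T, loB = v23_2 T\<rparr>"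

definition right_face :: "('e13, 'e1, 'e3, 'm) dvb" where
  "right_face = \<lparr>upA = v13_1 T, upB = v13_3 T, loA = v1 T, loB = v3 T\<rparr>"

definition up_face :: "('e, 'e13, 'e23, 'e3) dvb" where
  "up_face = \<lparr>upA = v13 T, upB = v23 T, loA = v13_3 T, loB = v23_3 T\<rparr>"

definition down_face :: "('e12, 'e1, 'e2, 'm) dvb" where
  "down_face = \<lparr>upA = v12_1 T, upB = v12_2 T, loA = v1 T, loB = v2 T\<rparr>"

definition ultracore :: "'e set" where
  "ultracore = {e \<in> pts (Tot (v12 T)). \<exists>m\<in>pts (Base (v1 T)).
     vproj (v12 T) e = vzero (v12_1 T) (vzero (v1 T) m) \<and>
     vproj (v12 T) e = vzero (v12_2 T) (vzero (v2 T) m) \<and>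
     vproj (v13 T) e = vzero (v13_1 T) (vzero (v1 T) m) \<and>
     vproj (v13 T) e = vzero (v13_3 T) (vzero (v3 T) m) \<and>
     vproj (v23 T) e = vzero (v23_2 T) (vzero (v2 T) m) \<and>
     vproj (v23 T) e = vzero (v23_3 T) (vzero (v3 T) m)}"

text \<open>The three additions of \<open>E\<close> coincide on the ultracore; we use that of \<open>E \<rightarrow> E\<^sub>1\<^sub>,\<^sub>2\<close>.\<close>

definition ultracore_vb :: "('e, 'm) vbundle" where
  "ultracore_vb =
     \<lparr>Tot = subspace (Tot (v12 T)) ultracore, Base = Base (v1 T),
      vproj = (\<lambda>e. vproj (v1 T) (vproj (v12_1 T) (vproj (v12 T) e))),
      vadd = vadd (v12 T), vscale = vscale (v12 T),
      vzero = (\<lambda>m. vzero (v12 T) (vzero (v12_1 T) (vzero (v1 T) m)))\<rparr>"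

text \<open>The core double vector bundles \<open>(E\<^sub>2\<^sub>3\<^sub>,\<^sub>1; E\<^sub>1, E\<^sub>2\<^sub>3; M)\<close>, \<open>(E\<^sub>1\<^sub>3\<^sub>,\<^sub>2; E\<^sub>2, E\<^sub>1\<^sub>3; M)\<close>, \<open>(E\<^sub>1\<^sub>2\<^sub>,\<^sub>3; E\<^sub>3, E\<^sub>1\<^sub>2; M)\<close>.\<close>

definition core_BF :: "('e, 'e1, 'e23, 'm) dvb" where
  "core_BF = \<lparr>upA = core_vb back_face, upB = restrict_vb (v23 T) (core back_face) (core front_face),
              loA = v1 T, loB = core_vb front_face\<rparr>"

definition core_LR :: "('e, 'e2, 'e13, 'm) dvb" where
  "core_LR = \<lparr>upA = core_vb left_face, upB = restrict_vb (v13 T) (core left_face) (core right_face),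
              loA = v2 T, loB = core_vb right_face\<rparr>"

definition core_UD :: "('e, 'e3, 'e12, 'm) dvb" where
  "core_UD = \<lparr>upA = core_vb up_face, upB = restrict_vb (v12 T) (core up_face) (core down_face),
              loA = v3 T, loB = core_vb down_face\<rparr>"

end

text \<open>
  \<open>operations_dvb_morphisms D D' V VA VB VM\<close>: the operations of \<open>V\<close> are morphisms of double vector
  bundles, where \<open>V\<close>, \<open>VA\<close>, \<open>VB\<close>, \<open>VM\<close> are the parallel bundles from the four corners of the face
  \<open>D\<close> to the corners of the opposite face \<open>D'\<close>.
\<close>

definition dvb_fibre_square ::
    "('d, 'a, 'b, 'm) dvb \<Rightarrow> ('d \<Rightarrow> 'd') \<Rightarrow> ('a \<Rightarrow> 'a') \<Rightarrow> ('b \<Rightarrow> 'b') \<Rightarrow> ('m \<Rightarrow> 'm') \<Rightarrow>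
     ('d \<times> 'd, 'a \<times> 'a, 'b \<times> 'b, 'm \<times> 'm) dvb" where
  "dvb_fibre_square D p pA pB pM =
     \<lparr>upA = fibre_square (upA D) p pA, upB = fibre_square (upB D) p pB,
      loA = fibre_square (loA D) pA pM, loB = fibre_square (loB D) pB pM\<rparr>"

definition operations_dvb_morphisms ::
    "('d, 'a, 'b, 'm) dvb \<Rightarrow> ('d', 'a', 'b', 'm') dvb \<Rightarrow>
     ('d, 'd') vbundle \<Rightarrow> ('a, 'a') vbundle \<Rightarrow> ('b, 'b') vbundle \<Rightarrow> ('m, 'm') vbundle \<Rightarrow> bool" where
  "operations_dvb_morphisms D D' V VA VB VM \<longleftrightarrow>
     dvb_morphism D D' (vproj V) (vproj VA) (vproj VB) (vproj VM) \<and>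
     dvb_morphism D' D (vzero V) (vzero VA) (vzero VB) (vzero VM) \<and>
     dvb_morphism (dvb_fibre_square D (vproj V) (vproj VA) (vproj VB) (vproj VM)) D
       (\<lambda>(x, y). vadd V x y) (\<lambda>(x, y). vadd VA x y)
       (\<lambda>(x, y). vadd VB x y) (\<lambda>(x, y). vadd VM x y) \<and>
     (\<forall>t. dvb_morphism D D (vscale V t) (vscale VA t) (vscale VB t) (vscale VM t))"

definition tvb_morphism ::
    "('e, 'e12, 'e13, 'e23, 'e1, 'e2, 'e3, 'm) tvb \<Rightarrow>
     ('f, 'f12, 'f13, 'f23, 'f1, 'f2, 'f3, 'n) tvb \<Rightarrow>
     ('e \<Rightarrow> 'f) \<Rightarrow> ('e12 \<Rightarrow> 'f12) \<Rightarrow> ('e13 \<Rightarrow> 'f13) \<Rightarrow> ('e23 \<Rightarrow> 'f23) \<Rightarrow>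
     ('e1 \<Rightarrow> 'f1) \<Rightarrow> ('e2 \<Rightarrow> 'f2) \<Rightarrow> ('e3 \<Rightarrow> 'f3) \<Rightarrow> ('m \<Rightarrow> 'n) \<Rightarrow> bool" where
  "tvb_morphism S T F F12 F13 F23 F1 F2 F3 F0 \<longleftrightarrow>
     vb_morphism (v12 S) (v12 T) F F12 \<and>
     vb_morphism (v13 S) (v13 T) F F13 \<and>
     vb_morphism (v23 S) (v23 T) F F23 \<and>
     vb_morphism (v12_1 S) (v12_1 T) F12 F1 \<and>
     vb_morphism (v12_2 S) (v12_2 T) F12 F2 \<and>
     vb_morphism (v13_1 S) (v13_1 T) F13 F1 \<and>
     vb_morphism (v13_3 S) (v13_3 T) F13 F3 \<and>
     vb_morphism (v23_2 S) (v23_2 T) F23 F2 \<and>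
     vb_morphism (v23_3 S) (v23_3 T) F23 F3 \<and>
     vb_morphism (v1 S) (v1 T) F1 F0 \<and>
     vb_morphism (v2 S) (v2 T) F2 F0 \<and>
     vb_morphism (v3 S) (v3 T) F3 F0"

definition inverse_on :: "'a smooth_space \<Rightarrow> 'b smooth_space \<Rightarrow> ('a \<Rightarrow> 'b) \<Rightarrow> ('b \<Rightarrow> 'a) \<Rightarrow> bool" where
  "inverse_on X Y f g \<longleftrightarrow> (\<forall>x\<in>pts X. g (f x) = x) \<and> (\<forall>y\<in>pts Y. f (g y) = y)"

definition tvb_isomorphism ::
    "('e, 'e12, 'e13, 'e23, 'e1, 'e2, 'e3, 'm) tvb \<Rightarrow>
     ('f, 'f12, 'f13, 'f23, 'f1, 'f2, 'f3, 'n) tvb \<Rightarrow>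
     ('e \<Rightarrow> 'f) \<Rightarrow> ('e12 \<Rightarrow> 'f12) \<Rightarrow> ('e13 \<Rightarrow> 'f13) \<Rightarrow> ('e23 \<Rightarrow> 'f23) \<Rightarrow>
     ('e1 \<Rightarrow> 'f1) \<Rightarrow> ('e2 \<Rightarrow> 'f2) \<Rightarrow> ('e3 \<Rightarrow> 'f3) \<Rightarrow> ('m \<Rightarrow> 'n) \<Rightarrow> bool" where
  "tvb_isomorphism S T F F12 F13 F23 F1 F2 F3 F0 \<longleftrightarrow>
     tvb_morphism S T F F12 F13 F23 F1 F2 F3 F0 \<and>
     (\<exists>G G12 G13 G23 G1 G2 G3 G0. tvb_morphism T S G G12 G13 G23 G1 G2 G3 G0 \<and>
        inverse_on (Tot (v12 S)) (Tot (v12 T)) F G \<and>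
        inverse_on (Tot (v12_1 S)) (Tot (v12_1 T)) F12 G12 \<and>
        inverse_on (Tot (v13_1 S)) (Tot (v13_1 T)) F13 G13 \<and>
        inverse_on (Tot (v23_2 S)) (Tot (v23_2 T)) F23 G23 \<and>
        inverse_on (Tot (v1 S)) (Tot (v1 T)) F1 G1 \<and>
        inverse_on (Tot (v2 S)) (Tot (v2 T)) F2 G2 \<and>
        inverse_on (Tot (v3 S)) (Tot (v3 T)) F3 G3 \<and>
        inverse_on (Base (v1 S)) (Base (v1 T)) F0 G0)"


subsection \<open>Decomposed triple vector bundles\<close>

text \<open>
  The lower faces: \<open>A \<times>\<^sub>M B \<times>\<^sub>M C\<close> as the pullback of \<open>B \<oplus> C\<close> to \<open>A\<close>, respectively of
  \<open>A \<oplus> C\<close> to \<open>B\<close>.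
\<close>

definition fibre_product3 ::
    "('a, 'm) vbundle \<Rightarrow> ('b, 'm) vbundle \<Rightarrow> ('c, 'm) vbundle \<Rightarrow> ('a \<times> 'b \<times> 'c) smooth_space" where
  "fibre_product3 A B C = subspace (prod_space (Tot A) (prod_space (Tot B) (Tot C)))
     {(a, b, c). vproj B b = vproj A a \<and> vproj C c = vproj A a}"

definition dec_over_A ::
    "('a, 'm) vbundle \<Rightarrow> ('b, 'm) vbundle \<Rightarrow> ('c, 'm) vbundle \<Rightarrow> ('a \<times> 'b \<times> 'c, 'a) vbundle" where
  "dec_over_A A B C =
     \<lparr>Tot = fibre_product3 A B C, Base = Tot A, vproj = (\<lambda>(a, b, c). a),
      vadd = (\<lambda>(a, b, c) (a', b', c'). (a, vadd B b b', vadd C c c')),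
      vscale = (\<lambda>t (a, b, c). (a, vscale B t b, vscale C t c)),
      vzero = (\<lambda>a. (a, vzero B (vproj A a), vzero C (vproj A a)))\<rparr>"

definition dec_over_B ::
    "('a, 'm) vbundle \<Rightarrow> ('b, 'm) vbundle \<Rightarrow> ('c, 'm) vbundle \<Rightarrow> ('a \<times> 'b \<times> 'c, 'b) vbundle" where
  "dec_over_B A B C =
     \<lparr>Tot = fibre_product3 A B C, Base = Tot B, vproj = (\<lambda>(a, b, c). b),
      vadd = (\<lambda>(a, b, c) (a', b', c'). (vadd A a a', b, vadd C c c')),
      vscale = (\<lambda>t (a, b, c). (vscale A t a, b, vscale C t c)),
      vzero = (\<lambda>b. (vzero A (vproj B b), b, vzero C (vproj B b)))\<rparr>"

context
  fixes A1 :: "('e1, 'm) vbundle" and A2 :: "('e2, 'm) vbundle" and A3 :: "('e3, 'm) vbundle"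
    and C12 :: "('c12, 'm) vbundle" and C13 :: "('c13, 'm) vbundle" and C23 :: "('c23, 'm) vbundle"
    and C123 :: "('c, 'm) vbundle"
begin

definition fibre_product7 ::
    "('e1 \<times> 'e2 \<times> 'e3 \<times> 'c12 \<times> 'c13 \<times> 'c23 \<times> 'c) smooth_space" where
  "fibre_product7 = subspace
     (prod_space (Tot A1) (prod_space (Tot A2) (prod_space (Tot A3)
       (prod_space (Tot C12) (prod_space (Tot C13) (prod_space (Tot C23) (Tot C123)))))))
     {(e1, e2, e3, c12, c13, c23, c). vproj A2 e2 = vproj A1 e1 \<and> vproj A3 e3 = vproj A1 e1 \<and>
        vproj C12 c12 = vproj A1 e1 \<and> vproj C13 c13 = vproj A1 e1 \<and> vproj C23 c23 = vproj A1 e1 \<and>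
        vproj C123 c = vproj A1 e1}"

definition decomposed_tvb ::
    "('e1 \<times> 'e2 \<times> 'e3 \<times> 'c12 \<times> 'c13 \<times> 'c23 \<times> 'c,
      'e1 \<times> 'e2 \<times> 'c12, 'e1 \<times> 'e3 \<times> 'c13, 'e2 \<times> 'e3 \<times> 'c23, 'e1, 'e2, 'e3, 'm) tvb" where
  "decomposed_tvb =
     \<lparr>v12 = \<lparr>Tot = fibre_product7, Base = fibre_product3 A1 A2 C12,
        vproj = (\<lambda>(e1, e2, e3, c12, c13, c23, c). (e1, e2, c12)),
        vadd = (\<lambda>(e1, e2, e3, c12, c13, c23, c) (e1', e2', e3', c12', c13', c23', c').
          (e1, e2, vadd A3 e3 e3', c12, vadd C13 c13 c13', vadd C23 c23 c23', vadd C123 c c')),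
        vscale = (\<lambda>t (e1, e2, e3, c12, c13, c23, c).
          (e1, e2, vscale A3 t e3, c12, vscale C13 t c13, vscale C23 t c23, vscale C123 t c)),
        vzero = (\<lambda>(e1, e2, c12). let m = vproj A1 e1 in
          (e1, e2, vzero A3 m, c12, vzero C13 m, vzero C23 m, vzero C123 m))\<rparr>,
      v13 = \<lparr>Tot = fibre_product7, Base = fibre_product3 A1 A3 C13,
        vproj = (\<lambda>(e1, e2, e3, c12, c13, c23, c). (e1, e3, c13)),
        vadd = (\<lambda>(e1, e2, e3, c12, c13, c23, c) (e1', e2', e3', c12', c13', c23', c').
          (e1, vadd A2 e2 e2', e3, vadd C12 c12 c12', c13, vadd C23 c23 c23', vadd C123 c c')),
        vscale = (\<lambda>t (e1, e2, e3, c12, c13, c23, c).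
          (e1, vscale A2 t e2, e3, vscale C12 t c12, c13, vscale C23 t c23, vscale C123 t c)),
        vzero = (\<lambda>(e1, e3, c13). let m = vproj A1 e1 in
          (e1, vzero A2 m, e3, vzero C12 m, c13, vzero C23 m, vzero C123 m))\<rparr>,
      v23 = \<lparr>Tot = fibre_product7, Base = fibre_product3 A2 A3 C23,
        vproj = (\<lambda>(e1, e2, e3, c12, c13, c23, c). (e2, e3, c23)),
        vadd = (\<lambda>(e1, e2, e3, c12, c13, c23, c) (e1', e2', e3', c12', c13', c23', c').
          (vadd A1 e1 e1', e2, e3, vadd C12 c12 c12', vadd C13 c13 c13', c23, vadd C123 c c')),
        vscale = (\<lambda>t (e1, e2, e3, c12, c13, c23, c).
          (vscale A1 t e1, e2, e3, vscale C12 t c12, vscale C13 t c13, c23, vscale C123 t c)),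
        vzero = (\<lambda>(e2, e3, c23). let m = vproj A2 e2 in
          (vzero A1 m, e2, e3, vzero C12 m, vzero C13 m, c23, vzero C123 m))\<rparr>,
      v12_1 = dec_over_A A1 A2 C12, v12_2 = dec_over_B A1 A2 C12,
      v13_1 = dec_over_A A1 A3 C13, v13_3 = dec_over_B A1 A3 C13,
      v23_2 = dec_over_A A2 A3 C23, v23_3 = dec_over_B A2 A3 C23,
      v1 = A1, v2 = A2, v3 = A3\<rparr>"

end

text \<open>
  A decomposition covers the identities of \<open>E\<^sub>1\<close>, \<open>E\<^sub>2\<close>, \<open>E\<^sub>3\<close> and \<open>M\<close>, and is the identity on the
  cores \<open>E\<^sub>1\<^sub>2\<close>, \<open>E\<^sub>1\<^sub>3\<close>, \<open>E\<^sub>2\<^sub>3\<close> of the lower faces and on the ultracore, as they sit in the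
  decomposed bundles.
\<close>

definition is_decomposition where
  "is_decomposition T F F12 F13 F23 F1 F2 F3 F0 \<longleftrightarrow>
     tvb_isomorphism T
       (decomposed_tvb (v1 T) (v2 T) (v3 T) (core_vb (down_face T)) (core_vb (right_face T))
          (core_vb (front_face T)) (ultracore_vb T))
       F F12 F13 F23 F1 F2 F3 F0 \<and>
     (\<forall>m\<in>pts (Base (v1 T)). F0 m = m) \<and>
     (\<forall>x\<in>pts (Tot (v1 T)). F1 x = x) \<and>
     (\<forall>x\<in>pts (Tot (v2 T)). F2 x = x) \<and>
     (\<forall>x\<in>pts (Tot (v3 T)). F3 x = x) \<and>
     (\<forall>c\<in>core (down_face T). let m = base_pt (down_face T) c in
        F12 c = (vzero (v1 T) m, vzero (v2 T) m, c)) \<and>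
     (\<forall>c\<in>core (right_face T). let m = base_pt (right_face T) c in
        F13 c = (vzero (v1 T) m, vzero (v3 T) m, c)) \<and>
     (\<forall>c\<in>core (front_face T). let m = base_pt (front_face T) c in
        F23 c = (vzero (v2 T) m, vzero (v3 T) m, c)) \<and>
     (\<forall>c\<in>ultracore T. let m = vproj (ultracore_vb T) c in
        F c = (vzero (v1 T) m, vzero (v2 T) m, vzero (v3 T) m, vzero (core_vb (down_face T)) m,
               vzero (core_vb (right_face T)) m, vzero (core_vb (front_face T)) m, c))"

definition triple_vector_bundle :: "('e, 'e12, 'e13, 'e23, 'e1, 'e2, 'e3, 'm) tvb \<Rightarrow> bool" where
  "triple_vector_bundle T \<longleftrightarrow>
     double_vector_bundle (back_face T) \<and> double_vector_bundle (front_face T) \<and>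
     double_vector_bundle (left_face T) \<and> double_vector_bundle (right_face T) \<and>
     double_vector_bundle (up_face T) \<and> double_vector_bundle (down_face T) \<and>
     operations_dvb_morphisms (up_face T) (down_face T) (v12 T) (v13_1 T) (v23_2 T) (v3 T) \<and>
     operations_dvb_morphisms (left_face T) (right_face T) (v13 T) (v12_1 T) (v23_3 T) (v2 T) \<and>
     operations_dvb_morphisms (back_face T) (front_face T) (v23 T) (v12_2 T) (v13_3 T) (v1 T) \<and>
     (\<exists>F F12 F13 F23 F1 F2 F3 F0. is_decomposition T F F12 F13 F23 F1 F2 F3 F0)"


section \<open>Grids, warps and ultrawarps\<close>

text \<open>
  \<open>X23 : E\<^sub>2\<^sub>,\<^sub>3 \<rightarrow> E\<close>, \<open>X2 : E\<^sub>2 \<rightarrow> E\<^sub>1\<^sub>,\<^sub>2\<close>, \<open>X3 : E\<^sub>3 \<rightarrow> E\<^sub>1\<^sub>,\<^sub>3\<close>, \<open>X0 : M \<rightarrow> E\<^sub>1\<close>, and similarly for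
  \<open>Y\<close> and \<open>Z\<close>; the core morphisms are \<open>core_morphism (front_face T) (X23 G)\<close> etc.
\<close>

record ('e, 'e12, 'e13, 'e23, 'e1, 'e2, 'e3, 'm) grid =
  X23 :: "'e23 \<Rightarrow> 'e"
  X2 :: "'e2 \<Rightarrow> 'e12"
  X3 :: "'e3 \<Rightarrow> 'e13"
  X0 :: "'m \<Rightarrow> 'e1"
  Y13 :: "'e13 \<Rightarrow> 'e"
  Y1 :: "'e1 \<Rightarrow> 'e12"
  Y3 :: "'e3 \<Rightarrow> 'e23"
  Y0 :: "'m \<Rightarrow> 'e2"
  Z12 :: "'e12 \<Rightarrow> 'e"
  Z1 :: "'e1 \<Rightarrow> 'e13"
  Z2 :: "'e2 \<Rightarrow> 'e23"
  Z0 :: "'m \<Rightarrow> 'e3"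

context
  fixes T :: "('e, 'e12, 'e13, 'e23, 'e1, 'e2, 'e3, 'm) tvb"
begin

definition front_back_linear_double_section ::
    "('e23 \<Rightarrow> 'e) \<Rightarrow> ('e2 \<Rightarrow> 'e12) \<Rightarrow> ('e3 \<Rightarrow> 'e13) \<Rightarrow> ('m \<Rightarrow> 'e1) \<Rightarrow> bool" where
  "front_back_linear_double_section s23 s2 s3 s \<longleftrightarrow>
     vb_section (v23 T) s23 \<and> vb_section (v12_2 T) s2 \<and> vb_section (v13_3 T) s3 \<and>
     vb_section (v1 T) s \<and> dvb_morphism (front_face T) (back_face T) s23 s2 s3 s"

definition right_left_linear_double_section ::
    "('e13 \<Rightarrow> 'e) \<Rightarrow> ('e1 \<Rightarrow> 'e12) \<Rightarrow> ('e3 \<Rightarrow> 'e23) \<Rightarrow> ('m \<Rightarrow> 'e2) \<Rightarrow> bool" where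
  "right_left_linear_double_section s13 s1 s3 s \<longleftrightarrow>
     vb_section (v13 T) s13 \<and> vb_section (v12_1 T) s1 \<and> vb_section (v23_3 T) s3 \<and>
     vb_section (v2 T) s \<and> dvb_morphism (right_face T) (left_face T) s13 s1 s3 s"

definition down_up_linear_double_section ::
    "('e12 \<Rightarrow> 'e) \<Rightarrow> ('e1 \<Rightarrow> 'e13) \<Rightarrow> ('e2 \<Rightarrow> 'e23) \<Rightarrow> ('m \<Rightarrow> 'e3) \<Rightarrow> bool" where
  "down_up_linear_double_section s12 s1 s2 s \<longleftrightarrow>
     vb_section (v12 T) s12 \<and> vb_section (v13_1 T) s1 \<and> vb_section (v23_2 T) s2 \<and>
     vb_section (v3 T) s \<and> dvb_morphism (down_face T) (up_face T) s12 s1 s2 s"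

definition is_grid :: "('e, 'e12, 'e13, 'e23, 'e1, 'e2, 'e3, 'm) grid \<Rightarrow> bool" where
  "is_grid G \<longleftrightarrow>
     front_back_linear_double_section (X23 G) (X2 G) (X3 G) (X0 G) \<and>
     right_left_linear_double_section (Y13 G) (Y1 G) (Y3 G) (Y0 G) \<and>
     down_up_linear_double_section (Z12 G) (Z1 G) (Z2 G) (Z0 G)"

context
  fixes G :: "('e, 'e12, 'e13, 'e23, 'e1, 'e2, 'e3, 'm) grid"
begin

definition w_back :: "'e1 \<Rightarrow> 'e" where
  "w_back e1 = core_difference (back_face T) (Z12 G (Y1 G e1)) (Y13 G (Z1 G e1))"

definition w_front :: "'m \<Rightarrow> 'e23" where
  "w_front m = core_difference (front_face T) (Z2 G (Y0 G m)) (Y3 G (Z0 G m))"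

definition w_left :: "'e2 \<Rightarrow> 'e" where
  "w_left e2 = core_difference (left_face T) (X23 G (Z2 G e2)) (Z12 G (X2 G e2))"

definition w_right :: "'m \<Rightarrow> 'e13" where
  "w_right m = core_difference (right_face T) (X3 G (Z0 G m)) (Z1 G (X0 G m))"

definition w_up :: "'e3 \<Rightarrow> 'e" where
  "w_up e3 = core_difference (up_face T) (Y13 G (X3 G e3)) (X23 G (Y3 G e3))"

definition w_down :: "'m \<Rightarrow> 'e12" where
  "w_down m = core_difference (down_face T) (Y1 G (X0 G m)) (X2 G (Y0 G m))"

definition u_BF :: "'m \<Rightarrow> 'e" where
  "u_BF m = core_difference (core_BF T)
     (w_back (X0 G m)) (core_morphism (front_face T) (X23 G) (w_front m))"

definition u_LR :: "'m \<Rightarrow> 'e" where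
  "u_LR m = core_difference (core_LR T)
     (w_left (Y0 G m)) (core_morphism (right_face T) (Y13 G) (w_right m))"

definition u_UD :: "'m \<Rightarrow> 'e" where
  "u_UD m = core_difference (core_UD T)
     (w_up (Z0 G m)) (core_morphism (down_face T) (Z12 G) (w_down m))"

end

end

end

theory Submission
  imports Defs "HOL-Algebra.Coset"
begin

text \<open>
  Over \<open>m\<close> put \<open>x = X(m)\<close>, \<open>y = Y(m)\<close>, \<open>z = Z(m)\<close>. Composing the sections of the grid in the six
  possible orders gives six points of \<open>E\<close>, all lying over \<open>x\<close>, \<open>y\<close>, \<open>z\<close>:
  \<open>a\<^sub>1 = Z\<^sub>1\<^sub>,\<^sub>2(Y\<^sub>1 x)\<close>, \<open>a\<^sub>2 = Y\<^sub>1\<^sub>,\<^sub>3(Z\<^sub>1 x)\<close>, \<open>b\<^sub>1 = X\<^sub>2\<^sub>,\<^sub>3(Z\<^sub>2 y)\<close>, \<open>b\<^sub>2 = Z\<^sub>1\<^sub>,\<^sub>2(X\<^sub>2 y)\<close>,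
  \<open>c\<^sub>1 = Y\<^sub>1\<^sub>,\<^sub>3(X\<^sub>3 z)\<close>, \<open>c\<^sub>2 = X\<^sub>2\<^sub>,\<^sub>3(Y\<^sub>3 z)\<close>.
  The warps of the upper faces are the core differences of \<open>a\<^sub>1, a\<^sub>2\<close>, of \<open>b\<^sub>1, b\<^sub>2\<close> and of
  \<open>c\<^sub>1, c\<^sub>2\<close>. By linearity of the double sections, the images of the warps of the lower faces are the
  core differences of \<open>b\<^sub>1, c\<^sub>2\<close>, of \<open>c\<^sub>1, a\<^sub>2\<close> and of \<open>a\<^sub>1, b\<^sub>2\<close>.

  A decomposition of \<open>E\<close> provides a map \<open>\<kappa> : E \<rightarrow> E\<^sub>1\<^sub>2\<^sub>3\<close>, its last component, which is additive for
  all three bundle structures of \<open>E\<close> and the identity on the ultracore (\<open>ultracore_component\<close>). Since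
  such a map sends zeros to zeros, it turns \<open>d - d' \<triangleright> c\<close> into \<open>\<kappa> d = \<kappa> d' + \<kappa> c\<close>
  (\<open>core_difference_additive\<close>), in the faces and in the core double vector bundles alike. Hence
  (\<open>ultrawarp_identity\<close>)
  \<open>u\<^sub>B\<^sub>F = (\<kappa> a\<^sub>1 - \<kappa> a\<^sub>2) - (\<kappa> b\<^sub>1 - \<kappa> c\<^sub>2)\<close>,
  \<open>u\<^sub>L\<^sub>R = (\<kappa> b\<^sub>1 - \<kappa> b\<^sub>2) - (\<kappa> c\<^sub>1 - \<kappa> a\<^sub>2)\<close>,
  \<open>u\<^sub>U\<^sub>D = (\<kappa> c\<^sub>1 - \<kappa> c\<^sub>2) - (\<kappa> a\<^sub>1 - \<kappa> b\<^sub>2)\<close>,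
  and each of the six values occurs once with each sign in the sum.

  What has to be checked beyond this is that the warps and ultrawarps, which are given by definite
  description, exist and are unique. For this, double vector bundles are replaced by the weaker
  notion \<open>dvb_laws\<close> (fibrewise abelian groups, linear projections, interchange law). It holds for the
  faces, is shown to pass to the core double vector bundles (\<open>core_BF_laws\<close>), and suffices for
  existence and uniqueness of core differences. The three core double vector bundles are treated at
  once, by permuting the three directions of the cube.
\<close>

section \<open>Bundles of groups\<close>

lemma pts_subspace [simp]: "pts (subspace X S) = pts X \<inter> S"
  by (simp add: pts_def subspace_def)

lemma pts_prod_space [simp]: "pts (prod_space X Y) = pts X \<times> pts Y"
  by (simp add: pts_def prod_space_def)

lemma smooth_map_pts: "smooth_map X Y f \<Longrightarrow> x \<in> pts X \<Longrightarrow> f x \<in> pts Y"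
  by (auto simp: smooth_map_def pts_def dest: continuous_map_funspace)

lemma (in comm_group) subgroup_comm_group:
  assumes "subgroup H G"
  shows "comm_group (G\<lparr>carrier := H\<rparr>)"
proof (rule group.group_comm_groupI[OF subgroup.subgroup_is_group[OF assms is_group]])
  fix x y assume "x \<in> carrier (G\<lparr>carrier := H\<rparr>)" "y \<in> carrier (G\<lparr>carrier := H\<rparr>)"
  then show "x \<otimes>\<^bsub>G\<lparr>carrier := H\<rparr>\<^esub> y = y \<otimes>\<^bsub>G\<lparr>carrier := H\<rparr>\<^esub> x"
    using subgroup.mem_carrier[OF assms] m_comm by simp
qed

definition fibre_group :: "('e, 'b) vbundle \<Rightarrow> 'b \<Rightarrow> 'e monoid" where
  "fibre_group V b = \<lparr>carrier = fibre V b, monoid.mult = vadd V, one = vzero V b\<rparr>"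

lemma fibre_group_simps [simp]:
  "carrier (fibre_group V b) = fibre V b"
  "monoid.mult (fibre_group V b) = vadd V"
  "one (fibre_group V b) = vzero V b"
  by (simp_all add: fibre_group_def)

definition group_bundle :: "('e, 'b) vbundle \<Rightarrow> bool" where
  "group_bundle V \<longleftrightarrow> (\<forall>e\<in>pts (Tot V). vproj V e \<in> pts (Base V)) \<and>
     (\<forall>b\<in>pts (Base V). comm_group (fibre_group V b))"

definition bundle_hom ::
    "('e, 'b) vbundle \<Rightarrow> ('f, 'c) vbundle \<Rightarrow> ('e \<Rightarrow> 'f) \<Rightarrow> ('b \<Rightarrow> 'c) \<Rightarrow> bool" where
  "bundle_hom V W F f \<longleftrightarrow> (\<forall>b\<in>pts (Base V). f b \<in> pts (Base W) \<and>
     F \<in> hom (fibre_group V b) (fibre_group W (f b)))"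

lemma vector_bundle_group_bundle:
  assumes "vector_bundle V"
  shows "group_bundle V"
proof -
  have "comm_group (fibre_group V b)" if "b \<in> pts (Base V)" for b
  proof -
    have vs: "real_vector_space_on (fibre V b) (vadd V) (vscale V) (vzero V b)"
      using assms that by (simp add: vector_bundle_def)
    show ?thesis
    proof (rule comm_groupI)
      fix x assume "x \<in> carrier (fibre_group V b)"
      then show "\<exists>y\<in>carrier (fibre_group V b).
          y \<otimes>\<^bsub>fibre_group V b\<^esub> x = \<one>\<^bsub>fibre_group V b\<^esub>"
        using vs by (simp add: real_vector_space_on_def) metis
    qed (use vs in \<open>auto simp: real_vector_space_on_def\<close>)
  qed
  then show ?thesis
    using assms by (auto simp: group_bundle_def vector_bundle_def dest: smooth_map_pts)
qed

lemma vb_morphism_bundle_hom: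
  assumes "vb_morphism V W F f"
  shows "bundle_hom V W F f"
  using assms unfolding vb_morphism_def bundle_hom_def
  by (auto simp: hom_def fibre_def Pi_iff dest: smooth_map_pts)

lemma bundle_hom_apply:
  assumes "bundle_hom V W F f" "group_bundle V"
  shows "x \<in> pts (Tot V) \<Longrightarrow> F x \<in> pts (Tot W)"
    and "x \<in> pts (Tot V) \<Longrightarrow> vproj W (F x) = f (vproj V x)"
    and "x \<in> pts (Tot V) \<Longrightarrow> y \<in> pts (Tot V) \<Longrightarrow> vproj V x = vproj V y \<Longrightarrow>
           F (vadd V x y) = vadd W (F x) (F y)"
  using assms unfolding bundle_hom_def group_bundle_def
  by (auto simp: hom_def fibre_def Pi_iff)

lemma bundle_hom_comp:
  assumes "bundle_hom V W F f" "bundle_hom W W' H h"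
  shows "bundle_hom V W' (\<lambda>x. H (F x)) (\<lambda>x. h (f x))"
  using assms unfolding bundle_hom_def by (auto simp: hom_def fibre_def Pi_iff)

lemma fibre_comm_group:
  assumes "group_bundle V" "x \<in> pts (Tot V)"
  shows "comm_group (fibre_group V (vproj V x))"
  using assms by (auto simp: group_bundle_def)

lemma bundle_hom_group_hom:
  assumes "bundle_hom V W F f" "group_bundle V" "group_bundle W" "b \<in> pts (Base V)"
  shows "group_hom (fibre_group V b) (fibre_group W (f b)) F"
  using assms unfolding bundle_hom_def group_bundle_def
  by (auto simp: group_hom_def group_hom_axioms_def comm_group_def)

lemma bundle_hom_zero:
  assumes "bundle_hom V W F f" "group_bundle V" "group_bundle W" "b \<in> pts (Base V)"
  shows "F (vzero V b) = vzero W (f b)"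
  using group_hom.hom_one[OF bundle_hom_group_hom[OF assms]] by simp

context
  fixes V :: "('e, 'b) vbundle"
  assumes gb: "group_bundle V"
begin

lemma vproj_pts: "x \<in> pts (Tot V) \<Longrightarrow> vproj V x \<in> pts (Base V)"
  using gb by (auto simp: group_bundle_def)

lemma vzero_in:
  assumes "b \<in> pts (Base V)"
  shows "vzero V b \<in> pts (Tot V)" "vproj V (vzero V b) = b"
proof -
  interpret comm_group "fibre_group V b" using gb assms by (simp add: group_bundle_def)
  show "vzero V b \<in> pts (Tot V)" "vproj V (vzero V b) = b"
    using one_closed by (auto simp: fibre_def)
qed

lemma vadd_zero:
  assumes "x \<in> pts (Tot V)"
  shows "vadd V x (vzero V (vproj V x)) = x" "vadd V (vzero V (vproj V x)) x = x"
proof -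
  interpret comm_group "fibre_group V (vproj V x)" using fibre_comm_group[OF gb assms] .
  show "vadd V x (vzero V (vproj V x)) = x" "vadd V (vzero V (vproj V x)) x = x"
    using r_one[of x] l_one[of x] assms by (auto simp: fibre_def)
qed

context
  fixes x y
  assumes xy: "x \<in> pts (Tot V)" "y \<in> pts (Tot V)" "vproj V x = vproj V y"
begin

lemma vadd_in: "vadd V x y \<in> pts (Tot V)" "vproj V (vadd V x y) = vproj V y"
proof -
  interpret comm_group "fibre_group V (vproj V y)" using fibre_comm_group[OF gb xy(2)] .
  show "vadd V x y \<in> pts (Tot V)" "vproj V (vadd V x y) = vproj V y"
    using m_closed[of x y] xy by (auto simp: fibre_def)
qed

lemma vadd_comm: "vadd V x y = vadd V y x"
proof -
  interpret comm_group "fibre_group V (vproj V y)" using fibre_comm_group[OF gb xy(2)] .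
  show ?thesis using m_comm[of x y] xy by (auto simp: fibre_def)
qed

lemma vadd_difference:
  obtains z where "z \<in> pts (Tot V)" "vproj V z = vproj V x" "x = vadd V y z"
proof -
  interpret comm_group "fibre_group V (vproj V y)" using fibre_comm_group[OF gb xy(2)] .
  let ?z = "inv\<^bsub>fibre_group V (vproj V y)\<^esub> y \<otimes>\<^bsub>fibre_group V (vproj V y)\<^esub> x"
  have "y \<in> fibre V (vproj V y)" "x \<in> fibre V (vproj V y)" using xy by (auto simp: fibre_def)
  then have "?z \<in> fibre V (vproj V y)" "x = vadd V y ?z"
    using m_closed[of "inv\<^bsub>fibre_group V (vproj V y)\<^esub> y" x] inv_closed[of y]
      m_assoc[of y "inv\<^bsub>fibre_group V (vproj V y)\<^esub> y" x] r_inv[of y] l_one[of x] by simp_all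
  then show thesis using that xy by (auto simp: fibre_def)
qed

lemma vadd_cancel:
  assumes "z \<in> pts (Tot V)" "vproj V z = vproj V y" "vadd V x z = vadd V x y"
  shows "z = y"
proof -
  interpret comm_group "fibre_group V (vproj V y)" using fibre_comm_group[OF gb xy(2)] .
  show ?thesis using Units_l_cancel[of x z y] Units_eq xy assms by (auto simp: fibre_def)
qed

end

lemma vadd_idem:
  assumes "x \<in> pts (Tot V)" "vadd V x x = x"
  shows "x = vzero V (vproj V x)"
  using vadd_cancel[of x "vzero V (vproj V x)" x] vadd_zero[OF assms(1)] assms
    vzero_in[OF vproj_pts[OF assms(1)]] by simp

end

section \<open>The algebra of double vector bundles\<close>

definition interchange_law :: "('d, 'a) vbundle \<Rightarrow> ('d, 'b) vbundle \<Rightarrow> bool" where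
  "interchange_law V W \<longleftrightarrow> (\<forall>x\<in>pts (Tot V). \<forall>y\<in>pts (Tot V). \<forall>x'\<in>pts (Tot V). \<forall>y'\<in>pts (Tot V).
     vproj V x = vproj V y \<longrightarrow> vproj V x' = vproj V y' \<longrightarrow>
     vproj W x = vproj W x' \<longrightarrow> vproj W y = vproj W y' \<longrightarrow>
     vadd W (vadd V x y) (vadd V x' y') = vadd V (vadd W x x') (vadd W y y'))"

text \<open>
  The part of the axioms of a double vector bundle that speaks about points and additions only. It is
  enough to compute with core differences, and can be verified for core double vector bundles without
  constructing their smooth structures.
\<close>

definition dvb_laws :: "('d, 'a, 'b, 'm) dvb \<Rightarrow> bool" where
  "dvb_laws D \<longleftrightarrow>
     group_bundle (upA D) \<and> group_bundle (upB D) \<and> group_bundle (loA D) \<and> group_bundle (loB D) \<and>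
     pts (Tot (upB D)) = pts (Tot (upA D)) \<and> pts (Base (upA D)) = pts (Tot (loA D)) \<and>
     pts (Base (upB D)) = pts (Tot (loB D)) \<and> pts (Base (loB D)) = pts (Base (loA D)) \<and>
     (\<forall>d\<in>pts (Tot (upA D)).
        vproj (loB D) (vproj (upB D) d) = vproj (loA D) (vproj (upA D) d)) \<and>
     bundle_hom (upB D) (loA D) (vproj (upA D)) (vproj (loB D)) \<and>
     bundle_hom (upA D) (loB D) (vproj (upB D)) (vproj (loA D)) \<and>
     interchange_law (upA D) (upB D)"

text \<open>
  The interchange law says that the addition of \<open>D \<rightarrow> A\<close>, a map on the fibre square of \<open>D \<rightarrow> B\<close>, is
  additive along \<open>D \<rightarrow> B\<close>.
\<close>

lemma double_vector_bundle_laws: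
  assumes "double_vector_bundle D"
  shows "dvb_laws D"
proof -
  let ?V = "upA D" and ?W = "upB D" and ?B = "loB D"
  have dvb: "vector_bundle ?V" "vector_bundle ?W" "vector_bundle (loA D)" "vector_bundle ?B"
    "Tot ?V = Tot ?W" "Base ?V = Tot (loA D)" "Base ?W = Tot ?B" "Base (loA D) = Base ?B"
    "\<forall>d\<in>pts (Tot ?V). vproj (loA D) (vproj ?V d) = vproj ?B (vproj ?W d)"
    "structure_maps_linear ?V ?W (loA D) ?B" "structure_maps_linear ?W ?V ?B (loA D)"
    using assms by (simp_all add: double_vector_bundle_def)
  have gW: "group_bundle ?W" using dvb vector_bundle_group_bundle by blast
  have add: "bundle_hom (fibre_square ?W (vproj ?V) (vproj ?B)) ?W
       (\<lambda>(d, d'). vadd ?V d d') (\<lambda>(b, b'). vadd ?B b b')"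
    using dvb(10) unfolding structure_maps_linear_def by (blast intro: vb_morphism_bundle_hom)
  have "interchange_law ?V ?W"
    unfolding interchange_law_def
  proof (intro ballI impI)
    fix x y x' y'
    assume *: "x \<in> pts (Tot ?V)" "y \<in> pts (Tot ?V)" "x' \<in> pts (Tot ?V)" "y' \<in> pts (Tot ?V)"
      "vproj ?V x = vproj ?V y" "vproj ?V x' = vproj ?V y'"
      "vproj ?W x = vproj ?W x'" "vproj ?W y = vproj ?W y'"
    let ?S = "fibre_square ?W (vproj ?V) (vproj ?B)"
    let ?b = "(vproj ?W x, vproj ?W y)"
    have "?b \<in> pts (Base ?S)"
      using *(1-5) dvb(5) bspec[OF dvb(9), of x] bspec[OF dvb(9), of y] vproj_pts[OF gW]
      by (simp add: fibre_square_def)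
    moreover have "(x, y) \<in> fibre ?S ?b" "(x', y') \<in> fibre ?S ?b"
      using * dvb(5) by (auto simp: fibre_square_def fibre_def)
    ultimately have "(\<lambda>(d, d'). vadd ?V d d') (vadd ?S (x, y) (x', y')) =
        vadd ?W (vadd ?V x y) (vadd ?V x' y')"
      using add by (simp add: bundle_hom_def hom_def)
    then show "vadd ?W (vadd ?V x y) (vadd ?V x' y') = vadd ?V (vadd ?W x x') (vadd ?W y y')"
      by (simp add: fibre_square_def)
  qed
  then show ?thesis
    using dvb unfolding dvb_laws_def structure_maps_linear_def
    by (simp add: vector_bundle_group_bundle vb_morphism_bundle_hom)
qed

lemma dvb_laws_swap:
  assumes "dvb_laws \<lparr>upA = V, upB = W, loA = VA, loB = VB\<rparr>"
  shows "dvb_laws \<lparr>upA = W, upB = V, loA = VB, loB = VA\<rparr>"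
proof -
  have "interchange_law W V"
    unfolding interchange_law_def
  proof (intro ballI impI)
    fix x y x' y'
    assume "x \<in> pts (Tot W)" "y \<in> pts (Tot W)" "x' \<in> pts (Tot W)" "y' \<in> pts (Tot W)"
      "vproj W x = vproj W y" "vproj W x' = vproj W y'"
      "vproj V x = vproj V x'" "vproj V y = vproj V y'"
    then have "vadd W (vadd V x x') (vadd V y y') = vadd V (vadd W x y) (vadd W x' y')"
      using assms unfolding dvb_laws_def interchange_law_def by simp
    then show "vadd V (vadd W x y) (vadd W x' y') = vadd W (vadd V x x') (vadd V y y')" ..
  qed
  then show ?thesis using assms by (simp add: dvb_laws_def)
qed

context
  fixes D :: "('d, 'a, 'b, 'm) dvb"
  assumes laws: "dvb_laws D"
begin

lemma dvb_lawsD: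
  shows "group_bundle (upA D)" "group_bundle (upB D)" "group_bundle (loA D)" "group_bundle (loB D)"
    and "pts (Tot (upB D)) = pts (Tot (upA D))" "pts (Base (upA D)) = pts (Tot (loA D))"
    and "pts (Base (upB D)) = pts (Tot (loB D))" "pts (Base (loB D)) = pts (Base (loA D))"
    and "d \<in> pts (Tot (upA D)) \<Longrightarrow>
      vproj (loB D) (vproj (upB D) d) = vproj (loA D) (vproj (upA D) d)"
    and "bundle_hom (upB D) (loA D) (vproj (upA D)) (vproj (loB D))"
    and "bundle_hom (upA D) (loB D) (vproj (upB D)) (vproj (loA D))"
    and "interchange_law (upA D) (upB D)"
  using laws unfolding dvb_laws_def by auto

lemmas group_upA = dvb_lawsD(1) and group_upB = dvb_lawsD(2)
  and group_loA = dvb_lawsD(3) and group_loB = dvb_lawsD(4)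
lemmas vproj_upA = bundle_hom_apply[OF dvb_lawsD(10) group_upB]
  and vproj_upB = bundle_hom_apply[OF dvb_lawsD(11) group_upA]

lemma core_iff:
  "c \<in> core D \<and> base_pt D c = m \<longleftrightarrow> c \<in> pts (Tot (upA D)) \<and> m \<in> pts (Base (loA D)) \<and>
     vproj (upA D) c = vzero (loA D) m \<and> vproj (upB D) c = vzero (loB D) m"
  using vzero_in(2)[OF group_loA] vproj_pts[OF group_upA] vproj_pts[OF group_loA]
  by (auto simp: core_def base_pt_def dvb_lawsD(6))

lemma vzero_upA:
  assumes "a \<in> pts (Tot (loA D))"
  shows "vzero (upA D) a \<in> pts (Tot (upA D))" "vproj (upA D) (vzero (upA D) a) = a"
    "vproj (upB D) (vzero (upA D) a) = vzero (loB D) (vproj (loA D) a)"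
  using vzero_in[OF group_upA] assms bundle_hom_zero[OF dvb_lawsD(11) group_upA group_loB] by (auto simp: dvb_lawsD)

lemma vzero_upB:
  assumes "b \<in> pts (Tot (loB D))"
  shows "vzero (upB D) b \<in> pts (Tot (upA D))" "vproj (upB D) (vzero (upB D) b) = b"
    "vproj (upA D) (vzero (upB D) b) = vzero (loA D) (vproj (loB D) b)"
  using vzero_in[OF group_upB] assms bundle_hom_zero[OF dvb_lawsD(10) group_upB group_loA] by (auto simp: dvb_lawsD)

text \<open>
  By the interchange law, the sum \<open>w\<close> along \<open>D \<rightarrow> B\<close> of two zeros of \<open>D \<rightarrow> A\<close> satisfies
  \<open>w +\<^sub>A w = w\<close>, so it is itself a zero of \<open>D \<rightarrow> A\<close>.
\<close>

lemma vzero_bundle_hom: "bundle_hom (loA D) (upB D) (vzero (upA D)) (vzero (loB D))"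
proof -
  let ?A = "upA D" and ?B = "upB D"
  have "vzero ?A (vadd (loA D) a a') = vadd ?B (vzero ?A a) (vzero ?A a')"
    if a: "a \<in> pts (Tot (loA D))" "a' \<in> pts (Tot (loA D))" "vproj (loA D) a = vproj (loA D) a'"
    for a a'
  proof -
    let ?w = "vadd ?B (vzero ?A a) (vzero ?A a')"
    note z = vzero_upA[OF a(1)] and z' = vzero_upA[OF a(2)]
    have w: "?w \<in> pts (Tot ?A)" "vproj ?A ?w = vadd (loA D) a a'"
      using vadd_in[OF group_upB, of "vzero ?A a" "vzero ?A a'"] vproj_upA(3)[of "vzero ?A a" "vzero ?A a'"]
        z z' a(3) by (simp_all add: dvb_lawsD)
    have "vadd ?B (vadd ?A (vzero ?A a) (vzero ?A a)) (vadd ?A (vzero ?A a') (vzero ?A a')) =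
        vadd ?A ?w ?w"
      using dvb_lawsD(12) z z' a(3) unfolding interchange_law_def by simp
    then have "vadd ?A ?w ?w = ?w"
      using vadd_zero(1)[OF group_upA z(1)] vadd_zero(1)[OF group_upA z'(1)] z(2) z'(2) by simp
    then show ?thesis using vadd_idem[OF group_upA w(1)] w(2) by simp
  qed
  moreover have "vzero (loB D) m \<in> pts (Base (upB D))" if "m \<in> pts (Base (loA D))" for m
    using vzero_in(1)[OF group_loB, of m] that by (simp add: dvb_lawsD)
  ultimately show ?thesis
    using vzero_upA unfolding bundle_hom_def hom_def by (simp add: fibre_def Pi_iff dvb_lawsD)
qed

lemma vzero_vzero:
  assumes "m \<in> pts (Base (loA D))"
  shows "vzero (upA D) (vzero (loA D) m) = vzero (upB D) (vzero (loB D) m)"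
  using bundle_hom_zero[OF vzero_bundle_hom group_loA group_upB assms] .

lemma core_translate:
  assumes "c \<in> core D" "a \<in> pts (Tot (loA D))" "base_pt D c = vproj (loA D) a"
  shows "vadd (upB D) c (vzero (upA D) a) \<in> pts (Tot (upA D))"
    "vproj (upA D) (vadd (upB D) c (vzero (upA D) a)) = a"
proof -
  have c: "c \<in> pts (Tot (upA D))" "vproj (upA D) c = vzero (loA D) (vproj (loA D) a)"
      "vproj (upB D) c = vzero (loB D) (vproj (loA D) a)"
    using core_iff[of c "vproj (loA D) a"] assms by auto
  then show "vadd (upB D) c (vzero (upA D) a) \<in> pts (Tot (upA D))"
    using vadd_in(1)[OF group_upB, of c "vzero (upA D) a"] vzero_upA[OF assms(2)] by (simp add: dvb_lawsD)
  show "vproj (upA D) (vadd (upB D) c (vzero (upA D) a)) = a"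
    using c vproj_upA(3)[of c "vzero (upA D) a"] vzero_upA[OF assms(2)] vadd_zero(2)[OF group_loA assms(2)]
    by (simp add: dvb_lawsD)
qed

lemma core_difference_rel_unique:
  assumes "core_difference_rel D d d' c" "core_difference_rel D d d' c'"
  shows "c = c'"
proof -
  let ?A = "upA D" and ?B = "upB D"
  let ?a = "vproj ?A d"
  have d: "d \<in> pts (Tot ?A)" "d' \<in> pts (Tot ?A)" "vproj ?A d' = ?a"
    and a: "?a \<in> pts (Tot (loA D))"
    using assms vproj_pts[OF group_upA] by (auto simp: core_difference_rel_def dvb_lawsD)
  have c: "c \<in> core D" "base_pt D c = vproj (loA D) ?a"
      "c' \<in> core D" "base_pt D c' = vproj (loA D) ?a"
    and eq: "vadd ?A d' (vadd ?B c (vzero ?A ?a)) = vadd ?A d' (vadd ?B c' (vzero ?A ?a))"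
    using assms by (auto simp: core_difference_rel_def base_pt_def)
  have "vadd ?B c (vzero ?A ?a) = vadd ?B c' (vzero ?A ?a)"
    using vadd_cancel[OF group_upA d(2) _ _ _ _ eq] core_translate[OF c(1) a c(2)]
      core_translate[OF c(3) a c(4)] d(3) by simp
  then show ?thesis
    using vadd_cancel[OF group_upB, of "vzero ?A ?a" c' c] vzero_upA[OF a] core_iff[of c "vproj (loA D) ?a"]
      core_iff[of c' "vproj (loA D) ?a"] c
      vadd_comm[OF group_upB, of c "vzero ?A ?a"] vadd_comm[OF group_upB, of c' "vzero ?A ?a"]
    by (simp add: dvb_lawsD)
qed

text \<open>
  The core element is obtained by subtracting twice: \<open>e = d -\<^sub>A d'\<close> lies over \<open>a\<close> and a zero of \<open>B\<close>,
  and \<open>c = e -\<^sub>B 0\<^sub>a\<close> lies over zeros. The second description of \<open>d\<close> follows from the first one by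
  the interchange law.
\<close>

lemma core_difference_rel_exists:
  assumes d: "d \<in> pts (Tot (upA D))" "d' \<in> pts (Tot (upA D))"
    "vproj (upA D) d = vproj (upA D) d'" "vproj (upB D) d = vproj (upB D) d'"
  shows "\<exists>c. core_difference_rel D d d' c"
proof -
  let ?A = "upA D" and ?B = "upB D"
  define a b m where "a = vproj ?A d'" and "b = vproj ?B d'" and "m = vproj (loA D) a"
  have a: "a \<in> pts (Tot (loA D))" and b: "b \<in> pts (Tot (loB D))" and mb: "vproj (loB D) b = m"
    using d vproj_pts[OF group_upA] vproj_pts[OF group_upB] by (simp_all add: a_def b_def m_def dvb_lawsD)
  then have m: "m \<in> pts (Base (loA D))" using vproj_pts[OF group_loA] by (simp add: m_def)
  obtain e where "e \<in> pts (Tot ?A)" "vproj ?A e = vproj ?A d" "d = vadd ?A d' e"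
    by (rule vadd_difference[OF group_upA d(1-3)])
  then have e: "e \<in> pts (Tot ?A)" "vproj ?A e = a" "d = vadd ?A d' e"
    using d(3) by (simp_all only: a_def)
  have "vadd (loB D) b (vproj ?B e) = b"
    using vproj_upB(3)[of d' e] e d by (simp add: a_def b_def)
  then have Be: "vproj ?B e = vzero (loB D) m"
    using vadd_cancel[OF group_loB b, of "vzero (loB D) m" "vproj ?B e"] vadd_zero(1)[OF group_loB b]
      vzero_in[OF group_loB, of m] vproj_upB(1,2)[of e] e(1,2) m mb by (simp add: m_def dvb_lawsD)
  note z = vzero_upA[OF a, folded m_def] and z' = vzero_upB[OF b, unfolded mb]
  have "e \<in> pts (Tot ?B)" "vzero ?A a \<in> pts (Tot ?B)" "vproj ?B e = vproj ?B (vzero ?A a)"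
    using e(1) z Be by (simp_all add: dvb_lawsD)
  then obtain c where "c \<in> pts (Tot ?B)" "vproj ?B c = vproj ?B e" "e = vadd ?B (vzero ?A a) c"
    by (rule vadd_difference[OF group_upB])
  then have c: "c \<in> pts (Tot ?A)" "vproj ?B c = vzero (loB D) m" "e = vadd ?B (vzero ?A a) c"
    using Be by (simp_all only: dvb_lawsD)
  have "vadd (loA D) a (vproj ?A c) = a"
    using vproj_upA(3)[of "vzero ?A a" c] z c e(2) by (simp add: dvb_lawsD)
  then have eq: "vadd (loA D) a (vproj ?A c) = vadd (loA D) a (vzero (loA D) m)"
    using vadd_zero(1)[OF group_loA a] by (simp add: m_def)
  have Ac: "vproj ?A c = vzero (loA D) m"
  proof (rule vadd_cancel[OF group_loA a _ _ _ _ eq])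
    show "vproj (loA D) (vproj ?A c) = vproj (loA D) (vzero (loA D) m)"
      using vproj_upA(2)[of c] c(1,2) vzero_in(2)[OF group_loA m] vzero_in(2)[OF group_loB, of m] m
      by (simp add: dvb_lawsD(5,8))
  qed (use vzero_in[OF group_loA m] vproj_upA(1)[of c] c(1) in \<open>simp_all add: m_def dvb_lawsD(5)\<close>)
  have core: "c \<in> core D" "base_pt D c = m"
    using core_iff[of c m] c m Ac by auto
  \<comment> \<open>This is \<open>(d' +\<^sub>A 0\<^sub>a) +\<^sub>B (0\<^sub>b +\<^sub>A c) = (d' +\<^sub>B 0\<^sub>b) +\<^sub>A (0\<^sub>a +\<^sub>B c)\<close>.\<close>
  have "vadd ?B (vadd ?A d' (vzero ?A a)) (vadd ?A (vzero ?B b) c) =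
      vadd ?A (vadd ?B d' (vzero ?B b)) (vadd ?B (vzero ?A a) c)"
    using dvb_lawsD(12) d z z' c Ac unfolding interchange_law_def
    by (simp add: a_def b_def)
  then have "vadd ?B d' (vadd ?A (vzero ?B b) c) = d"
    using vadd_zero(1)[OF group_upA d(2)] vadd_zero(1)[OF group_upB, of d'] d(2) e(3) c(3)
    by (simp add: a_def b_def dvb_lawsD)
  moreover have "vadd ?A (vzero ?B b) c = vadd ?A c (vzero ?B b)"
    using vadd_comm[OF group_upA, of "vzero ?B b" c] z' c Ac by simp
  moreover have "vadd ?B (vzero ?A a) c = vadd ?B c (vzero ?A a)"
    using vadd_comm[OF group_upB, of "vzero ?A a" c] z c by (simp add: dvb_lawsD)
  ultimately have "core_difference_rel D d d' c"
    using d core e(3) c(3) unfolding core_difference_rel_def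
    by (simp add: a_def b_def m_def base_pt_def)
  then show ?thesis ..
qed

lemma core_difference_eq:
  assumes "core_difference_rel D d d' c"
  shows "core_difference D d d' = c"
  unfolding core_difference_def using assms core_difference_rel_unique by blast

lemma core_difference_rel:
  assumes "d \<in> pts (Tot (upA D))" "d' \<in> pts (Tot (upA D))"
    "vproj (upA D) d = vproj (upA D) d'" "vproj (upB D) d = vproj (upB D) d'"
  shows "core_difference_rel D d d' (core_difference D d d')"
  using core_difference_rel_exists[OF assms] core_difference_eq by metis

text \<open>
  In \<open>d = d' +\<^sub>A (c +\<^sub>B 0\<^sub>a)\<close> the zero disappears under a map \<open>\<kappa>\<close> that is additive along both
  structures. The remaining conclusions say that the three values lie in one fibre of \<open>U\<close>, where the
  equation can be used.
\<close>

lemma core_difference_additive: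
  assumes U: "group_bundle U"
    and A: "bundle_hom (upA D) U \<kappa> f" and B: "bundle_hom (upB D) U \<kappa> g"
    and rel: "core_difference_rel D d d' c"
  shows "\<kappa> d = vadd U (\<kappa> d') (\<kappa> c)"
    "\<kappa> d \<in> pts (Tot U)" "\<kappa> d' \<in> pts (Tot U)" "\<kappa> c \<in> pts (Tot U)"
    "vproj U (\<kappa> d') = vproj U (\<kappa> d)" "vproj U (\<kappa> c) = vproj U (\<kappa> d)"
proof -
  let ?A = "upA D" and ?B = "upB D"
  let ?a = "vproj ?A d"
  have d: "d \<in> pts (Tot ?A)" "d' \<in> pts (Tot ?A)" "vproj ?A d' = ?a"
    and a: "?a \<in> pts (Tot (loA D))"
    using rel vproj_pts[OF group_upA] by (auto simp: core_difference_rel_def dvb_lawsD)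
  have c: "c \<in> core D" "base_pt D c = vproj (loA D) ?a"
    and eq: "d = vadd ?A d' (vadd ?B c (vzero ?A ?a))"
    using rel by (auto simp: core_difference_rel_def base_pt_def)
  have c': "c \<in> pts (Tot ?A)" "vproj ?B c = vzero (loB D) (vproj (loA D) ?a)"
    using core_iff[of c "vproj (loA D) ?a"] c by auto
  note z = vzero_upA[OF a] and t = core_translate[OF c(1) a c(2)]
  note kA = bundle_hom_apply[OF A group_upA] and kB = bundle_hom_apply[OF B group_upB, unfolded dvb_lawsD(5)]
  show "\<kappa> d \<in> pts (Tot U)" "\<kappa> d' \<in> pts (Tot U)" "\<kappa> c \<in> pts (Tot U)"
    using kA(1) d c' by auto
  show dd': "vproj U (\<kappa> d') = vproj U (\<kappa> d)" using kA(2) d by simp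
  have z0: "\<kappa> (vzero ?A ?a) = vzero U (vproj U (\<kappa> d))"
    using bundle_hom_zero[OF A group_upA U, of ?a] a kA(2)[OF d(1)] by (simp add: dvb_lawsD)
  have "vproj U (\<kappa> c) = vproj U (\<kappa> (vzero ?A ?a))" using kB(2) c' z by simp
  then show cd: "vproj U (\<kappa> c) = vproj U (\<kappa> d)"
    using kA(2) d z by simp
  have "\<kappa> (vadd ?B c (vzero ?A ?a)) = \<kappa> c"
    using kB(3)[of c "vzero ?A ?a"] c' z z0 vadd_zero(1)[OF U, of "\<kappa> c"] cd kA(1)[OF c'(1)] by simp
  moreover have "\<kappa> (vadd ?A d' (vadd ?B c (vzero ?A ?a))) =
      vadd U (\<kappa> d') (\<kappa> (vadd ?B c (vzero ?A ?a)))"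
    using kA(3)[OF d(2) t(1)] t d by simp
  ultimately show "\<kappa> d = vadd U (\<kappa> d') (\<kappa> c)" using eq by simp
qed

text \<open>
  The fibre of the core over \<open>m\<close> is the kernel of \<open>D \<rightarrow> B\<close> on the fibre of \<open>D \<rightarrow> A\<close> over the zero at
  \<open>m\<close>.
\<close>

lemma group_bundle_core_vb: "group_bundle (core_vb D)"
proof -
  have "comm_group (fibre_group (core_vb D) m)" if m: "m \<in> pts (Base (loA D))" for m
  proof -
    let ?z = "vzero (loA D) m"
    note z = vzero_in[OF group_loA m]
    interpret G: comm_group "fibre_group (upA D) ?z"
      using group_upA z by (simp add: group_bundle_def dvb_lawsD)
    interpret group_hom "fibre_group (upA D) ?z" "fibre_group (loB D) m" "vproj (upB D)"
      using bundle_hom_group_hom[OF dvb_lawsD(11) group_upA group_loB, of ?z] z by (simp add: dvb_lawsD)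
    let ?K = "kernel (fibre_group (upA D) ?z) (fibre_group (loB D) m) (vproj (upB D))"
    have "fibre (core_vb D) m = ?K"
      using core_iff[of _ m] m by (auto simp: fibre_def core_vb_def kernel_def core_def)
    then have "fibre_group (core_vb D) m = (fibre_group (upA D) ?z)\<lparr>carrier := ?K\<rparr>"
      by (simp add: fibre_group_def core_vb_def)
    then show ?thesis using G.subgroup_comm_group[OF subgroup_kernel] by simp
  qed
  moreover have "base_pt D c \<in> pts (Base (loA D))" if "c \<in> core D" for c
    using core_iff[of c] that by blast
  ultimately show ?thesis by (auto simp: group_bundle_def core_vb_def)
qed

end

definition dvb_hom ::
    "('d, 'a, 'b, 'm) dvb \<Rightarrow> ('d', 'a', 'b', 'm') dvb \<Rightarrow>
     ('d \<Rightarrow> 'd') \<Rightarrow> ('a \<Rightarrow> 'a') \<Rightarrow> ('b \<Rightarrow> 'b') \<Rightarrow> ('m \<Rightarrow> 'm') \<Rightarrow> bool" where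
  "dvb_hom D D' F FA FB f \<longleftrightarrow>
     bundle_hom (upA D) (upA D') F FA \<and> bundle_hom (upB D) (upB D') F FB \<and>
     bundle_hom (loA D) (loA D') FA f \<and> bundle_hom (loB D) (loB D') FB f"

lemma dvb_morphism_hom: "dvb_morphism D D' F FA FB f \<Longrightarrow> dvb_hom D D' F FA FB f"
  by (simp add: dvb_morphism_def dvb_hom_def vb_morphism_bundle_hom)

lemma dvb_hom_core:
  assumes D: "dvb_laws D" and D': "dvb_laws D'" and F: "dvb_hom D D' F FA FB f"
    and c: "c \<in> core D"
  shows "F c \<in> core D'" "base_pt D' (F c) = f (base_pt D c)"
proof -
  define m where "m = base_pt D c"
  have c': "c \<in> pts (Tot (upA D))" "m \<in> pts (Base (loA D))"
      "vproj (upA D) c = vzero (loA D) m" "vproj (upB D) c = vzero (loB D) m"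
    using core_iff[OF D, of c m] c by (auto simp: m_def)
  have hom: "bundle_hom (upA D) (upA D') F FA" "bundle_hom (upB D) (upB D') F FB"
     "bundle_hom (loA D) (loA D') FA f" "bundle_hom (loB D) (loB D') FB f"
    using F by (simp_all add: dvb_hom_def)
  have "f m \<in> pts (Base (loA D'))" using hom(3) c'(2) by (simp add: bundle_hom_def)
  then have "F c \<in> core D' \<and> base_pt D' (F c) = f m"
    using core_iff[OF D', of "F c" "f m"] c' bundle_hom_apply[OF hom(1) group_upA[OF D]]
      bundle_hom_apply[OF hom(2) group_upB[OF D]] bundle_hom_zero[OF hom(3) group_loA[OF D] group_loA[OF D']]
      bundle_hom_zero[OF hom(4) group_loB[OF D] group_loB[OF D']]
    by (simp add: dvb_lawsD[OF D])
  then show "F c \<in> core D'" "base_pt D' (F c) = f (base_pt D c)" by (simp_all add: m_def)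
qed

lemma dvb_hom_core_difference_rel:
  assumes D: "dvb_laws D" and D': "dvb_laws D'" and F: "dvb_hom D D' F FA FB f"
    and rel: "core_difference_rel D d d' c"
  shows "core_difference_rel D' (F d) (F d') (F c)"
proof -
  let ?A = "upA D" and ?B = "upB D" and ?A' = "upA D'" and ?B' = "upB D'"
  let ?a = "vproj ?A d" and ?b = "vproj ?B d"
  have d: "d \<in> pts (Tot ?A)" "d' \<in> pts (Tot ?A)" "vproj ?A d' = ?a" "vproj ?B d' = ?b"
    and eq: "d = vadd ?A d' (vadd ?B c (vzero ?A ?a))" "d = vadd ?B d' (vadd ?A c (vzero ?B ?b))"
    and core: "c \<in> core D" "base_pt D c = base_pt D d"
    using rel by (auto simp: core_difference_rel_def)
  have hom: "bundle_hom ?A ?A' F FA" "bundle_hom ?B ?B' F FB"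
     "bundle_hom (loA D) (loA D') FA f" "bundle_hom (loB D) (loB D') FB f"
    using F by (simp_all add: dvb_hom_def)
  note FA = bundle_hom_apply[OF hom(1) group_upA[OF D]]
    and FB = bundle_hom_apply[OF hom(2) group_upB[OF D], unfolded dvb_lawsD(5)[OF D]]
    and FloA = bundle_hom_apply[OF hom(3) group_loA[OF D]]
  have a: "?a \<in> pts (Tot (loA D))" and b: "?b \<in> pts (Tot (loB D))"
    and ab: "vproj (loB D) ?b = vproj (loA D) ?a"
    using vproj_pts[OF group_upA[OF D]] vproj_pts[OF group_upB[OF D]] d by (simp_all add: dvb_lawsD[OF D])
  have c: "c \<in> pts (Tot ?A)" "vproj ?A c = vzero (loA D) (vproj (loA D) ?a)"
      "vproj ?B c = vzero (loB D) (vproj (loA D) ?a)"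
    using core_iff[OF D, of c "vproj (loA D) ?a"] core by (auto simp: base_pt_def)
  note z = vzero_upA[OF D a] and z' = vzero_upB[OF D b, unfolded ab]
  note t = core_translate[OF D core(1) a core(2)[unfolded base_pt_def[of D d]]]
  have zero: "F (vzero ?A ?a) = vzero ?A' (FA ?a)" "F (vzero ?B ?b) = vzero ?B' (FB ?b)"
    using bundle_hom_zero[OF hom(1) group_upA[OF D] group_upA[OF D'], of ?a]
      bundle_hom_zero[OF hom(2) group_upB[OF D] group_upB[OF D'], of ?b] a b by (simp_all add: dvb_lawsD[OF D])
  have "F (vadd ?B c (vzero ?A ?a)) = vadd ?B' (F c) (vzero ?A' (FA ?a))"
    using FB(3)[OF c(1) z(1)] z c zero by simp
  moreover have "F (vadd ?A d' (vadd ?B c (vzero ?A ?a))) =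
      vadd ?A' (F d') (F (vadd ?B c (vzero ?A ?a)))"
    using FA(3)[OF d(2) t(1)] t d by simp
  ultimately have 1: "F d = vadd ?A' (F d') (vadd ?B' (F c) (vzero ?A' (vproj ?A' (F d))))"
    using eq(1) FA(2)[OF d(1)] by simp
  have u: "vadd ?A c (vzero ?B ?b) \<in> pts (Tot ?A)" "vproj ?B (vadd ?A c (vzero ?B ?b)) = ?b"
    using vadd_in(1)[OF group_upA[OF D], of c "vzero ?B ?b"] vproj_upB(3)[OF D, of c "vzero ?B ?b"] z' c
      vadd_zero(2)[OF group_loB[OF D] b] ab by simp_all
  have "F (vadd ?A c (vzero ?B ?b)) = vadd ?A' (F c) (vzero ?B' (FB ?b))"
    using FA(3)[OF c(1) z'(1)] z' c zero by simp
  moreover have "F (vadd ?B d' (vadd ?A c (vzero ?B ?b))) =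
      vadd ?B' (F d') (F (vadd ?A c (vzero ?B ?b)))"
    using FB(3)[OF d(2) u(1)] u d by simp
  ultimately have 2: "F d = vadd ?B' (F d') (vadd ?A' (F c) (vzero ?B' (vproj ?B' (F d))))"
    using eq(2) FB(2)[OF d(1)] by simp
  have "base_pt D' (F d) = f (base_pt D d)"
    using FA(2)[OF d(1)] FloA(2)[OF a] by (simp add: base_pt_def)
  then have "base_pt D' (F c) = base_pt D' (F d)"
    using dvb_hom_core(2)[OF D D' F core(1)] core(2) by simp
  moreover have "vproj ?A' (F d) = vproj ?A' (F d')" "vproj ?B' (F d) = vproj ?B' (F d')"
    using FA(2) FB(2) d by simp_all
  ultimately show ?thesis
    unfolding core_difference_rel_def
    using 1 2 FA(1)[OF d(1)] FA(1)[OF d(2)] dvb_hom_core(1)[OF D D' F core(1)] by blast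
qed

section \<open>Core double vector bundles of a triple vector bundle\<close>

lemma face_simps [simp]:
  "upA (back_face T) = v12 T" "upB (back_face T) = v13 T"
  "loA (back_face T) = v12_1 T" "loB (back_face T) = v13_1 T"
  "upA (front_face T) = v23_2 T" "upB (front_face T) = v23_3 T"
  "loA (front_face T) = v2 T" "loB (front_face T) = v3 T"
  "upA (left_face T) = v12 T" "upB (left_face T) = v23 T"
  "loA (left_face T) = v12_2 T" "loB (left_face T) = v23_2 T"
  "upA (right_face T) = v13_1 T" "upB (right_face T) = v13_3 T"
  "loA (right_face T) = v1 T" "loB (right_face T) = v3 T"
  "upA (up_face T) = v13 T" "upB (up_face T) = v23 T"
  "loA (up_face T) = v13_3 T" "loB (up_face T) = v23_3 T"
  "upA (down_face T) = v12_1 T" "upB (down_face T) = v12_2 T"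
  "loA (down_face T) = v1 T" "loB (down_face T) = v2 T"
  by (simp_all add: back_face_def front_face_def left_face_def right_face_def up_face_def
      down_face_def)

lemma core_BF_simps [simp]:
  "upA (core_BF T) = core_vb (back_face T)"
  "upB (core_BF T) = restrict_vb (v23 T) (core (back_face T)) (core (front_face T))"
  "loA (core_BF T) = v1 T" "loB (core_BF T) = core_vb (front_face T)"
  by (simp_all add: core_BF_def)

lemma restrict_vb_simps [simp]:
  "Tot (restrict_vb V S R) = subspace (Tot V) S" "Base (restrict_vb V S R) = subspace (Base V) R"
  "vproj (restrict_vb V S R) = vproj V" "vadd (restrict_vb V S R) = vadd V"
  "vzero (restrict_vb V S R) = vzero V"
  by (simp_all add: restrict_vb_def)

lemma core_vb_simps [simp]:
  "Tot (core_vb D) = subspace (Tot (upA D)) (core D)" "Base (core_vb D) = Base (loA D)"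
  "vproj (core_vb D) = base_pt D" "vadd (core_vb D) = vadd (upA D)"
  "vzero (core_vb D) m = vzero (upA D) (vzero (loA D) m)"
  by (simp_all add: core_vb_def)

lemma bundle_hom_restrict_vb:
  "bundle_hom V U \<kappa> f \<Longrightarrow> bundle_hom (restrict_vb V S R) U \<kappa> f"
  by (auto simp: bundle_hom_def hom_def fibre_def)

lemma bundle_hom_core_vb:
  assumes D: "dvb_laws D" and \<kappa>: "bundle_hom (upA D) U \<kappa> f"
  shows "bundle_hom (core_vb D) U \<kappa> (\<lambda>m. f (vzero (loA D) m))"
proof -
  have "fibre (core_vb D) m \<subseteq> fibre (upA D) (vzero (loA D) m)" for m
    using core_iff[OF D, of _ m] by (auto simp: fibre_def)
  moreover have "vzero (loA D) m \<in> pts (Base (upA D))" if "m \<in> pts (Base (loA D))" for m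
    using vzero_in[OF group_loA[OF D] that] by (simp add: dvb_lawsD[OF D])
  ultimately show ?thesis
    using \<kappa> unfolding bundle_hom_def hom_def by (simp add: Pi_iff subset_iff) blast
qed

definition tvb_laws :: "('e, 'e12, 'e13, 'e23, 'e1, 'e2, 'e3, 'm) tvb \<Rightarrow> bool" where
  "tvb_laws T \<longleftrightarrow> dvb_laws (back_face T) \<and> dvb_laws (front_face T) \<and> dvb_laws (left_face T) \<and>
     dvb_laws (right_face T) \<and> dvb_laws (up_face T) \<and> dvb_laws (down_face T)"

context
  fixes T :: "('e, 'e12, 'e13, 'e23, 'e1, 'e2, 'e3, 'm) tvb"
  assumes laws: "tvb_laws T"
begin

lemma faces: "dvb_laws (back_face T)" "dvb_laws (front_face T)" "dvb_laws (left_face T)"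
    "dvb_laws (right_face T)" "dvb_laws (up_face T)" "dvb_laws (down_face T)"
  using laws by (simp_all add: tvb_laws_def)

lemmas backD = dvb_lawsD[OF faces(1), unfolded face_simps]
  and frontD = dvb_lawsD[OF faces(2), unfolded face_simps]
  and leftD = dvb_lawsD[OF faces(3), unfolded face_simps]
  and rightD = dvb_lawsD[OF faces(4), unfolded face_simps]
  and upD = dvb_lawsD[OF faces(5), unfolded face_simps]
  and downD = dvb_lawsD[OF faces(6), unfolded face_simps]

lemmas core_back_iff = core_iff[OF faces(1), unfolded face_simps]
  and core_front_iff = core_iff[OF faces(2), unfolded face_simps]

text \<open>
  Each of the four conditions is the linearity of a projection in one of the faces Left, Up, Down and
  Right.
\<close>

lemma back_front_hom: "dvb_hom (back_face T) (front_face T) (vproj (v23 T)) (vproj (v12_2 T))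
    (vproj (v13_3 T)) (vproj (v1 T))"
  using leftD(11) upD(11) downD(11) rightD(11) by (simp add: dvb_hom_def)

text \<open>
  Over \<open>w\<close> in the core of the front face, the core of the back face consists of the points of the fibre
  of \<open>E \<rightarrow> E\<^sub>2\<^sub>,\<^sub>3\<close> that project to the zeros in \<open>E\<^sub>1\<^sub>,\<^sub>2\<close> and \<open>E\<^sub>1\<^sub>,\<^sub>3\<close> over some common \<open>a \<in> E\<^sub>1\<close>. The
  projections to \<open>E\<^sub>1\<^sub>,\<^sub>2\<close> and \<open>E\<^sub>1\<^sub>,\<^sub>3\<close> are homomorphisms by the left and up faces, and the zero
  sections are homomorphisms in \<open>a\<close> by the down and right faces; so these points form a subgroup.
\<close>

lemma group_bundle_core_BF_upB:
  "group_bundle (restrict_vb (v23 T) (core (back_face T)) (core (front_face T)))"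
    (is "group_bundle ?V")
proof -
  have "comm_group (fibre_group ?V w)" if w: "w \<in> core (front_face T)" for w
  proof -
    define m where "m = base_pt (front_face T) w"
    have w': "w \<in> pts (Tot (v23_2 T))" "m \<in> pts (Base (v2 T))"
        "vproj (v23_2 T) w = vzero (v2 T) m" "vproj (v23_3 T) w = vzero (v3 T) m"
      using core_front_iff[of w m] w by (auto simp: m_def)
    have m1: "m \<in> pts (Base (v1 T))" using w'(2) by (simp add: downD)
    have wb: "w \<in> pts (Base (v23 T))" using w'(1) by (simp add: leftD)
    interpret G: comm_group "fibre_group (v23 T) w"
      using leftD(2) wb by (simp add: group_bundle_def)
    interpret p12: group_hom "fibre_group (v23 T) w" "fibre_group (v12_2 T) (vzero (v2 T) m)"
      "vproj (v12 T)"
      using bundle_hom_group_hom[OF leftD(10,2,3) wb] w'(3) by simp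
    interpret p13: group_hom "fibre_group (v23 T) w" "fibre_group (v13_3 T) (vzero (v3 T) m)"
      "vproj (v13 T)"
      using bundle_hom_group_hom[OF upD(10,2,3) wb] w'(4) by simp
    interpret z12: group_hom "fibre_group (v1 T) m" "fibre_group (v12_2 T) (vzero (v2 T) m)"
      "vzero (v12_1 T)"
      using bundle_hom_group_hom[OF vzero_bundle_hom[OF faces(6), unfolded face_simps]
          downD(3,2) m1] .
    interpret z13: group_hom "fibre_group (v1 T) m" "fibre_group (v13_3 T) (vzero (v3 T) m)"
      "vzero (v13_1 T)"
      using bundle_hom_group_hom[OF vzero_bundle_hom[OF faces(4), unfolded face_simps]
          rightD(3,2) m1] .
    let ?K = "{c \<in> fibre (v23 T) w. \<exists>a\<in>fibre (v1 T) m.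
        vproj (v12 T) c = vzero (v12_1 T) a \<and> vproj (v13 T) c = vzero (v13_1 T) a}"
    have "subgroup ?K (fibre_group (v23 T) w)"
    proof (rule G.subgroupI)
      have "vzero (v23 T) w \<in> ?K"
        using G.one_closed p12.hom_one p13.hom_one z12.hom_one z13.hom_one z12.G.one_closed
        by (auto intro!: bexI[of _ "vzero (v1 T) m"])
      then show "?K \<noteq> {}" by blast
    next
      fix c assume "c \<in> ?K"
      then obtain a where "c \<in> fibre (v23 T) w" "a \<in> fibre (v1 T) m"
        "vproj (v12 T) c = vzero (v12_1 T) a" "vproj (v13 T) c = vzero (v13_1 T) a" by blast
      then show "inv\<^bsub>fibre_group (v23 T) w\<^esub> c \<in> ?K"
        using G.inv_closed[of c] z12.G.inv_closed[of a] p12.hom_inv[of c] p13.hom_inv[of c]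
          z12.hom_inv[of a] z13.hom_inv[of a]
        by (auto intro!: bexI[of _ "inv\<^bsub>fibre_group (v1 T) m\<^esub> a"])
    next
      fix c c' assume "c \<in> ?K" "c' \<in> ?K"
      then obtain a a' where "c \<in> fibre (v23 T) w" "a \<in> fibre (v1 T) m"
        "vproj (v12 T) c = vzero (v12_1 T) a" "vproj (v13 T) c = vzero (v13_1 T) a"
        "c' \<in> fibre (v23 T) w" "a' \<in> fibre (v1 T) m"
        "vproj (v12 T) c' = vzero (v12_1 T) a'" "vproj (v13 T) c' = vzero (v13_1 T) a'" by blast
      then show "c \<otimes>\<^bsub>fibre_group (v23 T) w\<^esub> c' \<in> ?K"
        using G.m_closed[of c c'] z12.G.m_closed[of a a'] p12.hom_mult[of c c']
          p13.hom_mult[of c c'] z12.hom_mult[of a a'] z13.hom_mult[of a a']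
        by (auto intro!: bexI[of _ "vadd (v1 T) a a'"])
    qed auto
    moreover have "fibre ?V w = ?K"
    proof (rule Set.set_eqI)
      fix c
      \<comment> \<open>A point \<open>a\<close> as above automatically lies over the base point \<open>m\<close> of \<open>w\<close>.\<close>
      have over_m: "a \<in> fibre (v1 T) m \<longleftrightarrow> a \<in> pts (Tot (v1 T))"
        if "c \<in> fibre (v23 T) w" "vproj (v12 T) c = vzero (v12_1 T) a" "a \<in> pts (Tot (v1 T))" for a
      proof -
        have "vproj (v12_2 T) (vproj (v12 T) c) = vzero (v2 T) m"
          using that(1) leftD(9)[of c] w'(3) by (auto simp: fibre_def leftD)
        then have "vproj (v2 T) (vproj (v12_2 T) (vzero (v12_1 T) a)) = m"
          using that(2) vzero_in(2)[OF downD(4) w'(2)] by simp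
        moreover have "vproj (v2 T) (vproj (v12_2 T) (vzero (v12_1 T) a)) = vproj (v1 T) a"
          using downD(9)[of "vzero (v12_1 T) a"] vzero_in[OF downD(1), of a] that(3)
          by (simp add: downD)
        ultimately show ?thesis using that(3) by (simp add: fibre_def)
      qed
      have "c \<in> core (back_face T) \<longleftrightarrow> c \<in> pts (Tot (v12 T)) \<and> (\<exists>a\<in>pts (Tot (v1 T)).
          vproj (v12 T) c = vzero (v12_1 T) a \<and> vproj (v13 T) c = vzero (v13_1 T) a)"
        using core_back_iff[of c] by (auto simp: downD)
      then show "c \<in> fibre ?V w \<longleftrightarrow> c \<in> ?K"
        using over_m by (auto simp: fibre_def leftD(5))
    qed
    ultimately show ?thesis
      using G.subgroup_comm_group[of ?K] by (simp add: fibre_group_def)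
  qed
  moreover have "vproj (v23 T) c \<in> core (front_face T)" if "c \<in> core (back_face T)" for c
    using dvb_hom_core(1)[OF faces(1,2) back_front_hom that] .
  ultimately show ?thesis
    using vproj_pts[OF leftD(2)] by (auto simp: group_bundle_def)
qed

lemma core_BF_laws: "dvb_laws (core_BF T)"
proof -
  have coreE: "c \<in> pts (Tot (v12 T))" "vproj (v23 T) c \<in> core (front_face T)"
      "base_pt (front_face T) (vproj (v23 T) c) = vproj (v1 T) (base_pt (back_face T) c)"
      "base_pt (back_face T) c \<in> pts (Tot (v1 T))"
      "vproj (v12 T) c = vzero (v12_1 T) (base_pt (back_face T) c)"
    if "c \<in> core (back_face T)" for c
    using dvb_hom_core[OF faces(1,2) back_front_hom that] core_back_iff[of c "base_pt (back_face T) c"] that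
    by (auto simp: downD)
  have front_pts: "w \<in> pts (Tot (v23_2 T))" "w \<in> pts (Base (v23 T))"
    if "w \<in> core (front_face T)" for w
    using that core_front_iff[of w] by (auto simp: leftD)
  have "bundle_hom (v23 T) (v1 T) (\<lambda>c. vproj (v12_1 T) (vproj (v12 T) c))
      (\<lambda>w. vproj (v2 T) (vproj (v23_2 T) w))"
    using bundle_hom_comp[OF leftD(10) downD(10)] .
  then have 1: "bundle_hom (upB (core_BF T)) (v1 T) (base_pt (back_face T)) (base_pt (front_face T))"
    using bundle_hom_restrict_vb by (simp add: base_pt_def[abs_def])
  have 2: "bundle_hom (core_vb (back_face T)) (core_vb (front_face T)) (vproj (v23 T)) (vproj (v1 T))"
    unfolding bundle_hom_def hom_def
    using bundle_hom_apply(3)[OF leftD(11,1)] coreE vproj_pts[OF downD(3)] front_pts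
    by (auto simp: fibre_def downD front_pts)
  have 3: "interchange_law (core_vb (back_face T)) (upB (core_BF T))"
    unfolding interchange_law_def
  proof (intro ballI impI)
    fix x y x' y'
    assume pts: "x \<in> pts (Tot (core_vb (back_face T)))" "y \<in> pts (Tot (core_vb (back_face T)))"
      "x' \<in> pts (Tot (core_vb (back_face T)))" "y' \<in> pts (Tot (core_vb (back_face T)))"
      and proj: "vproj (core_vb (back_face T)) x = vproj (core_vb (back_face T)) y"
      "vproj (core_vb (back_face T)) x' = vproj (core_vb (back_face T)) y'"
      "vproj (upB (core_BF T)) x = vproj (upB (core_BF T)) x'"
      "vproj (upB (core_BF T)) y = vproj (upB (core_BF T)) y'"
    have "vproj (v12 T) x = vproj (v12 T) y" "vproj (v12 T) x' = vproj (v12 T) y'"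
      using coreE(5) pts proj by simp_all
    then show "vadd (upB (core_BF T)) (vadd (core_vb (back_face T)) x y) (vadd (core_vb (back_face T)) x' y') =
        vadd (core_vb (back_face T)) (vadd (upB (core_BF T)) x x') (vadd (upB (core_BF T)) y y')"
      using leftD(12) pts proj unfolding interchange_law_def by simp
  qed
  show ?thesis
    using 1 2 3 group_bundle_core_vb[OF faces(1)] group_bundle_core_vb[OF faces(2)]
      group_bundle_core_BF_upB downD(3) coreE front_pts
    by (auto simp: dvb_laws_def leftD downD)
qed

text \<open>
  The conditions defining the ultracore that do not appear literally in \<open>core (core_BF T)\<close> say that
  the two ways of taking zeros twice agree.
\<close>

lemma core_core_BF: "core (core_BF T) = ultracore T"
proof (rule equalityI; rule subsetI)
  fix u assume u: "u \<in> core (core_BF T)"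
  define m where "m = base_pt (core_BF T) u"
  have "u \<in> core (back_face T)" "base_pt (back_face T) u = vzero (v1 T) m" and m: "m \<in> pts (Base (v1 T))"
    and "vproj (v23 T) u = vzero (v23_2 T) (vzero (v2 T) m)"
    using core_iff[OF core_BF_laws, of u m] u by (auto simp: m_def)
  moreover have "u \<in> pts (Tot (v12 T))" "vproj (v12 T) u = vzero (v12_1 T) (vzero (v1 T) m)"
    "vproj (v13 T) u = vzero (v13_1 T) (vzero (v1 T) m)"
    using core_back_iff[of u "vzero (v1 T) m"] calculation by auto
  ultimately show "u \<in> ultracore T"
    unfolding ultracore_def
    using vzero_vzero[OF faces(6), of m] vzero_vzero[OF faces(4), of m] vzero_vzero[OF faces(2), of m] m
    by (auto simp: downD intro!: bexI[of _ m])
next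
  fix u assume "u \<in> ultracore T"
  then obtain m where m: "m \<in> pts (Base (v1 T))" and u: "u \<in> pts (Tot (v12 T))"
    "vproj (v12 T) u = vzero (v12_1 T) (vzero (v1 T) m)"
    "vproj (v13 T) u = vzero (v13_1 T) (vzero (v1 T) m)"
    "vproj (v23 T) u = vzero (v23_2 T) (vzero (v2 T) m)"
    by (auto simp: ultracore_def)
  have "u \<in> core (back_face T)" "base_pt (back_face T) u = vzero (v1 T) m"
    using core_back_iff[of u "vzero (v1 T) m"] u m vzero_in(1)[OF downD(3) m] by (simp_all add: downD)
  then show "u \<in> core (core_BF T)"
    using core_iff[OF core_BF_laws, of u m] u m by simp
qed

lemma group_bundle_ultracore_vb: "group_bundle (ultracore_vb T)"
proof -
  have "u \<in> pts (Tot (v12 T)) \<and> u \<in> core (back_face T)" if "u \<in> ultracore T" for u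
    using core_iff[OF core_BF_laws, of u] that by (auto simp: core_core_BF)
  then have "fibre_group (ultracore_vb T) m = fibre_group (core_vb (core_BF T)) m" for m
    unfolding fibre_group_def by (auto simp: fibre_def core_core_BF ultracore_vb_def base_pt_def)
  then show ?thesis
    using group_bundle_core_vb[OF core_BF_laws] vproj_pts[OF downD(3)] vproj_pts[OF downD(1)] vproj_pts[OF leftD(1)]
    by (auto simp: group_bundle_def ultracore_vb_def downD leftD)
qed

text \<open>
  The computation of one ultrawarp, with the points \<open>p, q\<close> of \<open>E\<close> and their projections \<open>r, t\<close> to
  \<open>E\<^sub>2\<^sub>,\<^sub>3\<close> left arbitrary: \<open>\<kappa> u = (\<kappa> p - \<kappa> q) - (\<kappa> (s r) - \<kappa> (s t))\<close>. In the application to the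
  Back-Front bundle these are \<open>a\<^sub>1, a\<^sub>2, Z\<^sub>2 y, Y\<^sub>3 z\<close>; the two other ultrawarps are instances for a cube
  with permuted directions. Since permuting directions reverses the orientation of some warps, the
  order of \<open>p, q\<close> must not be tied to a grid.
\<close>

lemma ultrawarp_identity:
  assumes s: "dvb_hom (front_face T) (back_face T) s s2 s3 s1"
    and is_section: "\<And>w. w \<in> pts (Tot (v23_2 T)) \<Longrightarrow> vproj (v23 T) (s w) = w"
    and U: "group_bundle U"
    and \<kappa>: "bundle_hom (v12 T) U \<kappa> f12" "bundle_hom (v13 T) U \<kappa> f13" "bundle_hom (v23 T) U \<kappa> f23"
    and p: "p \<in> pts (Tot (v12 T))" "q \<in> pts (Tot (v12 T))"
    and pq: "vproj (v12 T) p = vproj (v12 T) q" "vproj (v13 T) p = vproj (v13 T) q"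
    and base: "base_pt (back_face T) p = s1 m"
    and r: "r \<in> pts (Tot (v23_2 T))" "t \<in> pts (Tot (v23_2 T))"
    and rt: "vproj (v23_2 T) r = vproj (v23_2 T) t" "vproj (v23_3 T) r = vproj (v23_3 T) t"
    and base': "base_pt (front_face T) r = m"
    and proj: "vproj (v23 T) p = r" "vproj (v23 T) q = t"
  defines "u \<equiv> core_difference (core_BF T) (core_difference (back_face T) p q)
     (core_morphism (front_face T) s (core_difference (front_face T) r t))"
  shows "u \<in> ultracore T" "\<kappa> u \<in> fibre U (vproj U (\<kappa> p))"
    "\<kappa> p \<in> fibre U (vproj U (\<kappa> p))" "\<kappa> q \<in> fibre U (vproj U (\<kappa> p))"
    "\<kappa> (s r) \<in> fibre U (vproj U (\<kappa> p))" "\<kappa> (s t) \<in> fibre U (vproj U (\<kappa> p))"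
    "vadd U (\<kappa> p) (\<kappa> (s t)) = vadd U (vadd U (\<kappa> q) (\<kappa> (s r))) (\<kappa> u)"
proof -
  define w where "w = core_difference (back_face T) p q"
  define v where "v = core_difference (front_face T) r t"
  have w: "core_difference_rel (back_face T) p q w"
    unfolding w_def using core_difference_rel[OF faces(1)] p pq by simp
  have v: "core_difference_rel (front_face T) r t v"
    unfolding v_def using core_difference_rel[OF faces(2)] r rt by simp
  have wcore: "w \<in> core (back_face T)" "base_pt (back_face T) w = s1 m"
    and vcore: "v \<in> core (front_face T)" "base_pt (front_face T) v = m"
    using w v base base' by (simp_all add: core_difference_rel_def)
  \<comment> \<open>The warp of the back face projects to that of the front face, so \<open>w\<close> and \<open>s v\<close> have the same outline.\<close>
  have "core_difference_rel (front_face T) r t (vproj (v23 T) w)"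
    using dvb_hom_core_difference_rel[OF faces(1,2) back_front_hom w] proj by simp
  then have wv: "vproj (v23 T) w = v"
    using core_difference_rel_unique[OF faces(2) _ v] by blast
  have sv: "s v \<in> core (back_face T)" "base_pt (back_face T) (s v) = s1 m"
    using dvb_hom_core[OF faces(2,1) s vcore(1)] vcore(2) by simp_all
  have sec: "vproj (v23 T) (s v) = v" using is_section vcore(1) core_front_iff[of v m] vcore by blast
  have "w \<in> pts (Tot (v12 T))" "s v \<in> pts (Tot (v12 T))"
    using wcore sv core_back_iff by blast+
  then have u: "core_difference_rel (core_BF T) w (s v) u"
    using core_difference_rel[OF core_BF_laws, of w "s v"] wcore sv wv sec vcore(1)
    by (simp add: u_def w_def v_def core_morphism_def)
  then show "u \<in> ultracore T"
    using core_core_BF by (auto simp: core_difference_rel_def)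
  note kw = core_difference_additive[OF faces(1) U _ _ w, unfolded face_simps, OF \<kappa>(1,2)]
  have s': "bundle_hom (v23_2 T) (v12 T) s s2" "bundle_hom (v23_3 T) (v13 T) s s3"
    using s by (simp_all add: dvb_hom_def)
  \<comment> \<open>Composed with the linear section \<open>s\<close>, the map \<open>\<kappa>\<close> is additive on the front face.\<close>
  note kv = core_difference_additive[OF faces(2) U _ _ v, unfolded face_simps,
      OF bundle_hom_comp[OF s'(1) \<kappa>(1)] bundle_hom_comp[OF s'(2) \<kappa>(2)]]
  note ku = core_difference_additive[OF core_BF_laws U _ _ u, unfolded core_BF_simps,
      OF bundle_hom_core_vb[OF faces(1)] bundle_hom_restrict_vb, unfolded face_simps, OF \<kappa>(1,3)]
  let ?b = "vproj U (\<kappa> p)" and ?G = "fibre_group U (vproj U (\<kappa> p))"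
  interpret comm_group "fibre_group U ?b" using fibre_comm_group[OF U kw(2)] .
  show mem: "\<kappa> u \<in> fibre U ?b" "\<kappa> p \<in> fibre U ?b" "\<kappa> q \<in> fibre U ?b"
    "\<kappa> (s r) \<in> fibre U ?b" "\<kappa> (s t) \<in> fibre U ?b"
    using kw(2-) kv(2-) ku(2-) by (auto simp: fibre_def)
  have memv: "\<kappa> (s v) \<in> fibre U ?b" using kw(2-) kv(2-) ku(2-) by (auto simp: fibre_def)
  have ac: "(a \<otimes>\<^bsub>?G\<^esub> (b \<otimes>\<^bsub>?G\<^esub> c)) \<otimes>\<^bsub>?G\<^esub> d = (a \<otimes>\<^bsub>?G\<^esub> (d \<otimes>\<^bsub>?G\<^esub> b)) \<otimes>\<^bsub>?G\<^esub> c"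
    if "a \<in> carrier ?G" "b \<in> carrier ?G" "c \<in> carrier ?G" "d \<in> carrier ?G" for a b c d
    using that by (simp add: m_ac del: fibre_group_simps)
  have "vadd U (vadd U (\<kappa> q) (vadd U (\<kappa> (s v)) (\<kappa> u))) (\<kappa> (s t)) =
      vadd U (vadd U (\<kappa> q) (vadd U (\<kappa> (s t)) (\<kappa> (s v)))) (\<kappa> u)"
    using ac[of "\<kappa> q" "\<kappa> (s v)" "\<kappa> u" "\<kappa> (s t)"] mem memv by simp
  then show "vadd U (\<kappa> p) (\<kappa> (s t)) = vadd U (vadd U (\<kappa> q) (\<kappa> (s r))) (\<kappa> u)"
    using kw(1) kv(1) ku(1) by simp
qed

end

section \<open>Permuting the directions of the cube\<close>

text \<open>
  The permutations are chosen such that they carry \<open>core_BF\<close> to \<open>core_LR\<close> and \<open>core_UD\<close> literally, which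
  requires the first structure \<open>upA\<close> of the back face to become that of the left and of the up face. In
  the other faces \<open>upA\<close> and \<open>upB\<close> may get exchanged; \<open>dvb_laws\<close> is symmetric in them.
\<close>

definition swap12_tvb ::
    "('e, 'e12, 'e13, 'e23, 'e1, 'e2, 'e3, 'm) tvb \<Rightarrow> ('e, 'e12, 'e23, 'e13, 'e2, 'e1, 'e3, 'm) tvb" where
  "swap12_tvb T = \<lparr>v12 = v12 T, v13 = v23 T, v23 = v13 T, v12_1 = v12_2 T, v12_2 = v12_1 T,
     v13_1 = v23_2 T, v13_3 = v23_3 T, v23_2 = v13_1 T, v23_3 = v13_3 T,
     v1 = v2 T, v2 = v1 T, v3 = v3 T\<rparr>"

definition rotate_tvb ::
    "('e, 'e12, 'e13, 'e23, 'e1, 'e2, 'e3, 'm) tvb \<Rightarrow> ('e, 'e13, 'e23, 'e12, 'e3, 'e1, 'e2, 'm) tvb" where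
  "rotate_tvb T = \<lparr>v12 = v13 T, v13 = v23 T, v23 = v12 T, v12_1 = v13_3 T, v12_2 = v13_1 T,
     v13_1 = v23_3 T, v13_3 = v23_2 T, v23_2 = v12_1 T, v23_3 = v12_2 T,
     v1 = v3 T, v2 = v1 T, v3 = v2 T\<rparr>"

lemma swap12_faces [simp]:
  "back_face (swap12_tvb T) = left_face T" "front_face (swap12_tvb T) = right_face T"
  "core_BF (swap12_tvb T) = core_LR T"
  by (simp_all add: swap12_tvb_def back_face_def front_face_def left_face_def right_face_def
      core_BF_def core_LR_def)

lemma rotate_faces [simp]:
  "back_face (rotate_tvb T) = up_face T" "front_face (rotate_tvb T) = down_face T"
  "core_BF (rotate_tvb T) = core_UD T"
  by (simp_all add: rotate_tvb_def back_face_def front_face_def up_face_def down_face_def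
      core_BF_def core_UD_def)

lemma swap12_simps [simp]:
  "v12 (swap12_tvb T) = v12 T" "v13 (swap12_tvb T) = v23 T" "v23 (swap12_tvb T) = v13 T"
  "v23_2 (swap12_tvb T) = v13_1 T" "v23_3 (swap12_tvb T) = v13_3 T"
  by (simp_all add: swap12_tvb_def)

lemma rotate_simps [simp]:
  "v12 (rotate_tvb T) = v13 T" "v13 (rotate_tvb T) = v23 T" "v23 (rotate_tvb T) = v12 T"
  "v23_2 (rotate_tvb T) = v12_1 T" "v23_3 (rotate_tvb T) = v12_2 T"
  by (simp_all add: rotate_tvb_def)

context
  fixes T :: "('e, 'e12, 'e13, 'e23, 'e1, 'e2, 'e3, 'm) tvb"
  assumes laws: "tvb_laws T"
begin

lemma tvb_laws_swap12: "tvb_laws (swap12_tvb T)"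
  using faces[OF laws] dvb_laws_swap[OF faces(5)[OF laws, unfolded up_face_def]]
    dvb_laws_swap[OF faces(6)[OF laws, unfolded down_face_def]]
  unfolding tvb_laws_def swap12_faces
  by (simp add: swap12_tvb_def back_face_def front_face_def left_face_def right_face_def up_face_def down_face_def)

lemma tvb_laws_rotate: "tvb_laws (rotate_tvb T)"
  using faces[OF laws] dvb_laws_swap[OF faces(1)[OF laws, unfolded back_face_def]]
    dvb_laws_swap[OF faces(2)[OF laws, unfolded front_face_def]]
    dvb_laws_swap[OF faces(3)[OF laws, unfolded left_face_def]]
    dvb_laws_swap[OF faces(4)[OF laws, unfolded right_face_def]]
  unfolding tvb_laws_def rotate_faces
  by (simp add: rotate_tvb_def left_face_def right_face_def up_face_def down_face_def)

lemma ultracore_swap12: "ultracore (swap12_tvb T) = ultracore T"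
  by (auto simp: ultracore_def swap12_tvb_def downD[OF laws])

lemma ultracore_rotate: "ultracore (rotate_tvb T) = ultracore T"
  by (auto simp: ultracore_def rotate_tvb_def backD[OF laws] rightD[OF laws])

end

section \<open>The ultracore component of a decomposition\<close>

lemma triple_vector_bundle_laws: "triple_vector_bundle T \<Longrightarrow> tvb_laws T"
  by (simp add: triple_vector_bundle_def tvb_laws_def double_vector_bundle_laws)

lemma bundle_hom_component:
  assumes F: "bundle_hom V W F F'" "group_bundle V" and U: "group_bundle U"
    and add: "\<And>p q. k (vadd W p q) = vadd U (k p) (k q)"
    and proj: "\<And>e. e \<in> pts (Tot V) \<Longrightarrow> k (F e) \<in> pts (Tot U) \<and> vproj U (k (F e)) = f (vproj V e)"
  shows "bundle_hom V U (\<lambda>e. k (F e)) f"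
proof -
  have "f b \<in> pts (Base U)" if "b \<in> pts (Base V)" for b
    using proj[of "vzero V b"] vzero_in[OF F(2) that] vproj_pts[OF U, of "k (F (vzero V b))"] by simp
  moreover have "k (F (vadd V e e')) = vadd U (k (F e)) (k (F e'))"
    if "e \<in> pts (Tot V)" "e' \<in> pts (Tot V)" "vproj V e = vproj V e'" for e e'
    using bundle_hom_apply(3)[OF F that] add by simp
  ultimately show ?thesis
    using proj unfolding bundle_hom_def hom_def by (auto simp: fibre_def)
qed

text \<open>
  In the decomposed triple vector bundle every addition is performed on the last component by the
  addition of the ultracore, so the last component of a decomposition is additive in all three
  directions.
\<close>

lemma ultracore_component:
  fixes T :: "('e, 'e12, 'e13, 'e23, 'e1, 'e2, 'e3, 'm) tvb"
  assumes T: "triple_vector_bundle T"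
  obtains \<kappa> f13 f23 where
    "bundle_hom (v12 T) (ultracore_vb T) \<kappa> (\<lambda>x. vproj (v1 T) (vproj (v12_1 T) x))"
    "bundle_hom (v13 T) (ultracore_vb T) \<kappa> f13"
    "bundle_hom (v23 T) (ultracore_vb T) \<kappa> f23"
    "\<And>u. u \<in> ultracore T \<Longrightarrow> \<kappa> u = u"
proof -
  note laws = triple_vector_bundle_laws[OF T]
  let ?U = "ultracore_vb T"
  let ?D = "decomposed_tvb (v1 T) (v2 T) (v3 T) (core_vb (down_face T)) (core_vb (right_face T))
      (core_vb (front_face T)) ?U"
  obtain F F12 F13 F23 F1 F2 F3 F0 where dec: "is_decomposition T F F12 F13 F23 F1 F2 F3 F0"
    using T by (auto simp: triple_vector_bundle_def)
  then have hom: "bundle_hom (v12 T) (v12 ?D) F F12" "bundle_hom (v13 T) (v13 ?D) F F13"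
    "bundle_hom (v23 T) (v23 ?D) F F23" "bundle_hom (v12_1 T) (v12_1 ?D) F12 F1"
    by (simp_all add: is_decomposition_def tvb_isomorphism_def tvb_morphism_def
        vb_morphism_bundle_hom)
  define k :: "'e1 \<times> 'e2 \<times> 'e3 \<times> 'e12 \<times> 'e13 \<times> 'e23 \<times> 'e \<Rightarrow> 'e"
    where "k = (\<lambda>(e1, e2, e3, c12, c13, c23, c). c)"
  define \<kappa> where "\<kappa> = (\<lambda>e. k (F e))"
  note gb = leftD(1)[OF laws] backD(2)[OF laws] leftD(2)[OF laws] downD(1)[OF laws]
  have inU: "\<kappa> e \<in> pts (Tot ?U)" "vproj ?U (\<kappa> e) = vproj (v1 T) (fst (F e))"
    "vproj (v2 T) (fst (snd (F e))) = vproj (v1 T) (fst (F e))"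
    "fst (F e) \<in> pts (Tot (v1 T))"
    if "e \<in> pts (Tot (v12 T))" for e
    using bundle_hom_apply(1)[OF hom(1) gb(1) that]
    by (auto simp: decomposed_tvb_def fibre_product7_def \<kappa>_def k_def)
  have F12: "fst (F12 x) = vproj (v12_1 T) x" if "x \<in> pts (Tot (v12_1 T))" for x
  proof -
    have "F1 (vproj (v12_1 T) x) = vproj (v12_1 T) x"
      using dec vproj_pts[OF gb(4) that] by (simp add: is_decomposition_def downD[OF laws])
    then show ?thesis
      using bundle_hom_apply(2)[OF hom(4) gb(4) that]
      by (simp add: decomposed_tvb_def dec_over_A_def split: prod.splits)
  qed
  have first: "fst (vproj (v12 ?D) p) = fst p" "fst (vproj (v13 ?D) p) = fst p"
      "fst (vproj (v23 ?D) p) = fst (snd p)" for p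
    by (simp_all add: decomposed_tvb_def split: prod.splits)
  have base12: "fst (F e) = vproj (v12_1 T) (vproj (v12 T) e)" if "e \<in> pts (Tot (v12 T))" for e
    using bundle_hom_apply(2)[OF hom(1) gb(1) that] F12[of "vproj (v12 T) e"]
      vproj_pts[OF gb(1) that] first(1)[of "F e"] by (simp add: leftD[OF laws] downD[OF laws])
  have base13: "fst (F e) = fst (F13 (vproj (v13 T) e))" if "e \<in> pts (Tot (v12 T))" for e
    using bundle_hom_apply(2)[OF hom(2) gb(2)] that backD(5)[OF laws] first(2)[of "F e"] by simp
  have base23: "fst (snd (F e)) = fst (F23 (vproj (v23 T) e))" if "e \<in> pts (Tot (v12 T))" for e
    using bundle_hom_apply(2)[OF hom(3) gb(3)] that leftD(5)[OF laws] first(3)[of "F e"] by simp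
  have add: "k (vadd (v12 ?D) p q) = vadd ?U (k p) (k q)"
      "k (vadd (v13 ?D) p q) = vadd ?U (k p) (k q)"
      "k (vadd (v23 ?D) p q) = vadd ?U (k p) (k q)" for p q
    by (simp_all add: decomposed_tvb_def k_def split: prod.splits)
  note U = group_bundle_ultracore_vb[OF laws]
  have 1: "bundle_hom (v12 T) ?U \<kappa> (\<lambda>x. vproj (v1 T) (vproj (v12_1 T) x))"
    unfolding \<kappa>_def using bundle_hom_component[OF hom(1) gb(1) U add(1)] inU base12
    by (simp add: \<kappa>_def)
  have 2: "bundle_hom (v13 T) ?U \<kappa> (\<lambda>x. vproj (v1 T) (fst (F13 x)))"
    unfolding \<kappa>_def using bundle_hom_component[OF hom(2) gb(2) U add(2)] inU base13
    by (simp add: \<kappa>_def backD(5)[OF laws])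
  have 3: "bundle_hom (v23 T) ?U \<kappa> (\<lambda>x. vproj (v2 T) (fst (F23 x)))"
    unfolding \<kappa>_def using bundle_hom_component[OF hom(3) gb(3) U add(3)] inU base23
    by (simp add: \<kappa>_def leftD(5)[OF laws])
  have "\<kappa> u = u" if "u \<in> ultracore T" for u
    using dec that by (simp add: is_decomposition_def \<kappa>_def k_def Let_def)
  then show thesis using that 1 2 3 by blast
qed

section \<open>The ultrawarps of a grid\<close>

text \<open>
  Each of the three sums on the left differs from the next one by one of the \<open>u\<^sub>i\<close>, and the third
  leads back to the first.
\<close>

lemma (in comm_group) hexagon:
  assumes "a1 \<in> carrier G" "a2 \<in> carrier G" "b1 \<in> carrier G" "b2 \<in> carrier G"
    "c1 \<in> carrier G" "c2 \<in> carrier G" "u1 \<in> carrier G" "u2 \<in> carrier G" "u3 \<in> carrier G"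
    and "a1 \<otimes> c2 = a2 \<otimes> b1 \<otimes> u1" "b1 \<otimes> a2 = b2 \<otimes> c1 \<otimes> u2" "c1 \<otimes> b2 = c2 \<otimes> a1 \<otimes> u3"
  shows "u1 \<otimes> u2 \<otimes> u3 = \<one>"
proof -
  have "a1 \<otimes> c2 = (a1 \<otimes> c2) \<otimes> (u1 \<otimes> u2 \<otimes> u3)"
  proof -
    have "a1 \<otimes> c2 = b1 \<otimes> a2 \<otimes> u1" using assms by (simp add: m_comm)
    also have "\<dots> = c1 \<otimes> b2 \<otimes> u2 \<otimes> u1" using assms by (simp add: m_comm)
    also have "\<dots> = c2 \<otimes> a1 \<otimes> u3 \<otimes> u2 \<otimes> u1" using assms by simp
    also have "\<dots> = (a1 \<otimes> c2) \<otimes> (u1 \<otimes> u2 \<otimes> u3)" using assms(1-9) by (simp add: m_ac)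
    finally show ?thesis .
  qed
  then show ?thesis using l_cancel_one'[of "a1 \<otimes> c2" "u1 \<otimes> u2 \<otimes> u3"] assms(1-9) by simp
qed

theorem theorem8:
  fixes T :: "('e, 'e12, 'e13, 'e23, 'e1, 'e2, 'e3, 'm) tvb"
    and G :: "('e, 'e12, 'e13, 'e23, 'e1, 'e2, 'e3, 'm) grid"
  assumes "triple_vector_bundle T"
    and "is_grid T G"
  shows "\<forall>m\<in>pts (Base (v1 T)).
           vadd (ultracore_vb T) (vadd (ultracore_vb T) (u_BF T G m) (u_LR T G m)) (u_UD T G m)
             = vzero (ultracore_vb T) m"
proof
  fix m assume m: "m \<in> pts (Base (v1 T))"
  note laws = triple_vector_bundle_laws[OF assms(1)]
  let ?U = "ultracore_vb T"
  have U: "group_bundle ?U" using group_bundle_ultracore_vb[OF laws] .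
  obtain \<kappa> f13 f23 where
    \<kappa>: "bundle_hom (v12 T) ?U \<kappa> (\<lambda>x. vproj (v1 T) (vproj (v12_1 T) x))"
       "bundle_hom (v13 T) ?U \<kappa> f13" "bundle_hom (v23 T) ?U \<kappa> f23"
    and \<kappa>_ultracore: "\<And>u. u \<in> ultracore T \<Longrightarrow> \<kappa> u = u"
    using ultracore_component[OF assms(1)] by blast
  have homs: "dvb_hom (front_face T) (back_face T) (X23 G) (X2 G) (X3 G) (X0 G)"
    "dvb_hom (right_face T) (left_face T) (Y13 G) (Y1 G) (Y3 G) (Y0 G)"
    "dvb_hom (down_face T) (up_face T) (Z12 G) (Z1 G) (Z2 G) (Z0 G)"
    using assms(2) by (simp_all add: is_grid_def front_back_linear_double_section_def
        right_left_linear_double_section_def down_up_linear_double_section_def dvb_morphism_hom)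
  note pts_faces = backD(5)[OF laws] leftD(5)[OF laws] downD(5)[OF laws] rightD(5)[OF laws]
    frontD(5)[OF laws] backD(6,7)[OF laws] leftD(7)[OF laws] downD(6,7,8)[OF laws]
    rightD(6,7,8)[OF laws] frontD(6,7)[OF laws]
  note hom = homs[unfolded dvb_hom_def face_simps]
  have sec: "\<And>x. x \<in> pts (Base (v23 T)) \<Longrightarrow> vproj (v23 T) (X23 G x) = x"
      "\<And>x. x \<in> pts (Base (v12_2 T)) \<Longrightarrow> vproj (v12_2 T) (X2 G x) = x"
      "\<And>x. x \<in> pts (Base (v13_3 T)) \<Longrightarrow> vproj (v13_3 T) (X3 G x) = x"
      "\<And>x. x \<in> pts (Base (v1 T)) \<Longrightarrow> vproj (v1 T) (X0 G x) = x"
      "\<And>x. x \<in> pts (Base (v13 T)) \<Longrightarrow> vproj (v13 T) (Y13 G x) = x"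
      "\<And>x. x \<in> pts (Base (v12_1 T)) \<Longrightarrow> vproj (v12_1 T) (Y1 G x) = x"
      "\<And>x. x \<in> pts (Base (v23_3 T)) \<Longrightarrow> vproj (v23_3 T) (Y3 G x) = x"
      "\<And>x. x \<in> pts (Base (v2 T)) \<Longrightarrow> vproj (v2 T) (Y0 G x) = x"
      "\<And>x. x \<in> pts (Base (v12 T)) \<Longrightarrow> vproj (v12 T) (Z12 G x) = x"
      "\<And>x. x \<in> pts (Base (v13_1 T)) \<Longrightarrow> vproj (v13_1 T) (Z1 G x) = x"
      "\<And>x. x \<in> pts (Base (v23_2 T)) \<Longrightarrow> vproj (v23_2 T) (Z2 G x) = x"
      "\<And>x. x \<in> pts (Base (v3 T)) \<Longrightarrow> vproj (v3 T) (Z0 G x) = x"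
    and sec0: "\<And>x. x \<in> pts (Base (v1 T)) \<Longrightarrow> X0 G x \<in> pts (Tot (v1 T))"
      "\<And>x. x \<in> pts (Base (v2 T)) \<Longrightarrow> Y0 G x \<in> pts (Tot (v2 T))"
      "\<And>x. x \<in> pts (Base (v3 T)) \<Longrightarrow> Z0 G x \<in> pts (Tot (v3 T))"
    using assms(2) by (auto simp: is_grid_def front_back_linear_double_section_def
        right_left_linear_double_section_def down_up_linear_double_section_def vb_section_def
        dest: smooth_map_pts)
  have X: "bundle_hom (v23_2 T) (v12 T) (X23 G) (X2 G)" "bundle_hom (v23_3 T) (v13 T) (X23 G) (X3 G)"
      "bundle_hom (v2 T) (v12_1 T) (X2 G) (X0 G)" "bundle_hom (v3 T) (v13_1 T) (X3 G) (X0 G)"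
    and Y: "bundle_hom (v13_1 T) (v12 T) (Y13 G) (Y1 G)" "bundle_hom (v13_3 T) (v23 T) (Y13 G) (Y3 G)"
      "bundle_hom (v1 T) (v12_2 T) (Y1 G) (Y0 G)" "bundle_hom (v3 T) (v23_2 T) (Y3 G) (Y0 G)"
    and Z: "bundle_hom (v12_1 T) (v13 T) (Z12 G) (Z1 G)" "bundle_hom (v12_2 T) (v23 T) (Z12 G) (Z2 G)"
      "bundle_hom (v1 T) (v13_3 T) (Z1 G) (Z0 G)" "bundle_hom (v2 T) (v23_3 T) (Z2 G) (Z0 G)"
    using hom by simp_all
  note lin' =
    bundle_hom_apply(1,2)[OF X(1) frontD(1)[OF laws]] bundle_hom_apply(1,2)[OF X(2) frontD(2)[OF laws]]
    bundle_hom_apply(1,2)[OF X(3) downD(4)[OF laws]] bundle_hom_apply(1,2)[OF X(4) rightD(4)[OF laws]]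
    bundle_hom_apply(1,2)[OF Y(1) rightD(1)[OF laws]] bundle_hom_apply(1,2)[OF Y(2) rightD(2)[OF laws]]
    bundle_hom_apply(1,2)[OF Y(3) downD(3)[OF laws]] bundle_hom_apply(1,2)[OF Y(4) rightD(4)[OF laws]]
    bundle_hom_apply(1,2)[OF Z(1) downD(1)[OF laws]] bundle_hom_apply(1,2)[OF Z(2) downD(2)[OF laws]]
    bundle_hom_apply(1,2)[OF Z(3) downD(3)[OF laws]] bundle_hom_apply(1,2)[OF Z(4) downD(4)[OF laws]]
  note lin = lin'[unfolded pts_faces] and sec = sec[unfolded pts_faces] and sec0 = sec0[unfolded pts_faces]
  define x y z where "x = X0 G m" and "y = Y0 G m" and "z = Z0 G m"
  have xyz: "x \<in> pts (Tot (v1 T))" "y \<in> pts (Tot (v2 T))" "z \<in> pts (Tot (v3 T))"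
    "vproj (v1 T) x = m" "vproj (v2 T) y = m" "vproj (v3 T) z = m" "X0 G m = x" "Y0 G m = y" "Z0 G m = z"
    using sec sec0 m by (simp_all add: pts_faces x_def y_def z_def)
  define a1 a2 b1 b2 c1 c2 where "a1 = Z12 G (Y1 G x)" and "a2 = Y13 G (Z1 G x)"
    and "b1 = X23 G (Z2 G y)" and "b2 = Z12 G (X2 G y)"
    and "c1 = Y13 G (X3 G z)" and "c2 = X23 G (Y3 G z)"
  note defs = a1_def a2_def b1_def b2_def c1_def c2_def
  \<comment> \<open>The hypotheses of \<open>ultrawarp_identity\<close> for the three directions: positions of the six points.\<close>
  have P1: "a1 \<in> pts (Tot (v12 T))" "a2 \<in> pts (Tot (v12 T))" "vproj (v12 T) a1 = vproj (v12 T) a2"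
      "vproj (v13 T) a1 = vproj (v13 T) a2" "base_pt (back_face T) a1 = X0 G m"
      "Z2 G y \<in> pts (Tot (v23_2 T))" "Y3 G z \<in> pts (Tot (v23_2 T))"
      "vproj (v23_2 T) (Z2 G y) = vproj (v23_2 T) (Y3 G z)"
      "vproj (v23_3 T) (Z2 G y) = vproj (v23_3 T) (Y3 G z)"
      "base_pt (front_face T) (Z2 G y) = m" "vproj (v23 T) a1 = Z2 G y" "vproj (v23 T) a2 = Y3 G z"
    by (simp_all add: defs base_pt_def lin sec xyz pts_faces)
  have P2: "b1 \<in> pts (Tot (v12 T))" "b2 \<in> pts (Tot (v12 T))" "vproj (v12 T) b1 = vproj (v12 T) b2"
      "vproj (v23 T) b1 = vproj (v23 T) b2" "base_pt (left_face T) b1 = Y0 G m"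
      "X3 G z \<in> pts (Tot (v13_1 T))" "Z1 G x \<in> pts (Tot (v13_1 T))"
      "vproj (v13_1 T) (X3 G z) = vproj (v13_1 T) (Z1 G x)"
      "vproj (v13_3 T) (X3 G z) = vproj (v13_3 T) (Z1 G x)"
      "base_pt (right_face T) (X3 G z) = m" "vproj (v13 T) b1 = X3 G z" "vproj (v13 T) b2 = Z1 G x"
    by (simp_all add: defs base_pt_def lin sec xyz pts_faces)
  have P3: "c1 \<in> pts (Tot (v13 T))" "c2 \<in> pts (Tot (v13 T))" "vproj (v13 T) c1 = vproj (v13 T) c2"
      "vproj (v23 T) c1 = vproj (v23 T) c2" "base_pt (up_face T) c1 = Z0 G m"
      "Y1 G x \<in> pts (Tot (v12_1 T))" "X2 G y \<in> pts (Tot (v12_1 T))"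
      "vproj (v12_1 T) (Y1 G x) = vproj (v12_1 T) (X2 G y)"
      "vproj (v12_2 T) (Y1 G x) = vproj (v12_2 T) (X2 G y)"
      "base_pt (down_face T) (Y1 G x) = m" "vproj (v12 T) c1 = Y1 G x" "vproj (v12 T) c2 = X2 G y"
    by (simp_all add: defs base_pt_def lin sec xyz pts_faces)
  have "\<And>w. w \<in> pts (Tot (v23_2 T)) \<Longrightarrow> vproj (v23 T) (X23 G w) = w"
    using sec(1) by simp
  note BF = ultrawarp_identity[OF laws homs(1) this U \<kappa> P1]
  have "\<And>w. w \<in> pts (Tot (v13_1 T)) \<Longrightarrow> vproj (v13 T) (Y13 G w) = w"
    using sec(5) by simp
  note LR = ultrawarp_identity[OF tvb_laws_swap12[OF laws], unfolded swap12_simps swap12_faces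
      ultracore_swap12[OF laws], OF homs(2) this U \<kappa>(1) \<kappa>(3) \<kappa>(2) P2]
  have "\<And>w. w \<in> pts (Tot (v12_1 T)) \<Longrightarrow> vproj (v12 T) (Z12 G w) = w"
    using sec(9) by simp
  note UD = ultrawarp_identity[OF tvb_laws_rotate[OF laws], unfolded rotate_simps rotate_faces
      ultracore_rotate[OF laws], OF homs(3) this U \<kappa>(2) \<kappa>(3) \<kappa>(1) P3]
  have u: "u_BF T G m = core_difference (core_BF T) (core_difference (back_face T) a1 a2)
        (core_morphism (front_face T) (X23 G) (core_difference (front_face T) (Z2 G y) (Y3 G z)))"
      "u_LR T G m = core_difference (core_LR T) (core_difference (left_face T) b1 b2)
        (core_morphism (right_face T) (Y13 G) (core_difference (right_face T) (X3 G z) (Z1 G x)))"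
      "u_UD T G m = core_difference (core_UD T) (core_difference (up_face T) c1 c2)
        (core_morphism (down_face T) (Z12 G) (core_difference (down_face T) (Y1 G x) (X2 G y)))"
    by (simp_all add: u_BF_def u_LR_def u_UD_def w_back_def w_front_def w_left_def w_right_def
        w_up_def w_down_def defs xyz)
  have \<kappa>a1: "vproj ?U (\<kappa> a1) = m"
    using bundle_hom_apply(2)[OF \<kappa>(1) leftD(1)[OF laws] P1(1)] by (simp add: defs lin sec xyz pts_faces)
  \<comment> \<open>\<open>b1\<close> and \<open>c1\<close> lie over \<open>m\<close> since each already occurs in the equation of an earlier ultrawarp.\<close>
  have \<kappa>b1: "vproj ?U (\<kappa> b1) = m"
    using BF(5) \<kappa>a1 by (simp add: b1_def fibre_def)
  have \<kappa>c1: "vproj ?U (\<kappa> c1) = m"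
    using LR(5) \<kappa>b1 by (simp add: c1_def fibre_def)
  interpret comm_group "fibre_group ?U m" using U m by (simp add: group_bundle_def ultracore_vb_def)
  let ?u1 = "u_BF T G m" and ?u2 = "u_LR T G m" and ?u3 = "u_UD T G m"
  note BF' = BF[folded u defs, unfolded \<kappa>a1] and LR' = LR[folded u defs, unfolded \<kappa>b1]
    and UD' = UD[folded u defs, unfolded \<kappa>c1]
  show "vadd ?U (vadd ?U ?u1 ?u2) ?u3 = vzero ?U m"
    using hexagon[of "\<kappa> a1" "\<kappa> a2" "\<kappa> b1" "\<kappa> b2" "\<kappa> c1" "\<kappa> c2" ?u1 ?u2 ?u3]
      BF' LR' UD' \<kappa>_ultracore by simp
qed

end
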